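(* Assume $\mu_{1,1}>\mu_{2,1}$. For every $\epsilon>0$, and for $\beta(t,\delta)=\log(4C_Kt/\delta)$ with $C_K$ as specified in the context, the Maximin-Racing algorithm satisfies $$\limsup_{\delta\to0}\frac{\mathbb E_{\bm\mu}[\tau_\delta(1,1)]}{\log(1/\delta)}\le\frac1{\max\left(\epsilon^2/2,\ I(\mu_{2,1},\mu_{1,1})\right)}$$ and, for any $(i,j)\ne(1,1)$, $$\limsup_{\delta\to0}\frac{\mathbb E_{\bm\mu}[\tau_\delta(i,j)]}{\log(1/\delta)}\le\frac1{\max\left(\epsilon^2/2,\ I(\mu_{i,1},\mu_{1,1}),\ I(\mu_{i,j},\mu_{i,1})\right)},$$ where $\tau_\delta(i,j)$ is the number of draws of arm $(i,j)$ and $I(x,y)=d\left(x,\tfrac{x+y}2\right)+d\left(y,\tfrac{x+y}2\right)$.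
   Context: **Bandit model.** Let $K\ge 2$, $K_1,\dots,K_K\ge 1$ be integers, $\mathcal P=\{(i,j):1\le i\le K,\ 1\le j\le K_i\}$, $\mathcal P_i=\{(i,j):1\le j\le K_i\}$ and $\overline K=\sum_i K_i$. Each arm $P\in\mathcal P$ is a Bernoulli distribution with unknown mean $\mu_P\in[0,1]$; draws of an arm are i.i.d., and arms are independent. $\mathbb E_{\bm\mu}$ is expectation under $\bm\mu=(\mu_P)_{P\in\mathcal P}$. For the analysis (unknown to the algorithm), actions are labelled so that for each $i$, $j\mapsto\mu_{i,j}$ is nondecreasing, and $i\mapsto\mu_{i,1}$ is nonincreasing; thus action $1$ is a maximin action. $d(x,y)=x\log(x/y)+(1-x)\log((1-x)/(1-y))$ is the binary relative entropy. **Maximin-Racing algorithm** (elimination function $f$, threshold function $\beta$). The elimination function used is $f(x,y)=\left[d\left(x,\tfrac{x+y}2\right)+d\left(y,\tfrac{x+y}2\right)\right]\mathbf 1_{(x\ge y)}$. Initialize $\mathcal R_i=\mathcal P_i$ for each $i$ and $\mathcal R=\mathcal R_1\cup\dots\cup\mathcal R_K$ (the active arms). At round $r=1,2,\dots$: - All arms in $\mathcal R$ are drawn once; $\hat\mu_P(r)$ denotes the average of the $r$ observations of arm $P\in\mathcal R$. - *High arms elimination:* for each $i$ with $|\mathcal R_i|\ge2$, if $r f\left(\max_{P\in\mathcal R_i}\hat\mu_P(r),\min_{P\in\mathcal R_i}\hat\mu_P(r)\right)\ge\beta(r,\delta)$, then $P_m\in\operatorname{argmax}_{P\in\mathcal R_i}\hat\mu_P(r)$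 is removed from $\mathcal R_i$ and $\mathcal R$. - *Action elimination:* let $(\tilde\imath,\tilde\jmath)\in\operatorname{argmin}_{P\in\mathcal R}\hat\mu_P(r)$; if $r f\left(\max_{i\ne\tilde\imath}\min_{P\in\mathcal R_i}\hat\mu_P(r),\hat\mu_{(\tilde\imath,\tilde\jmath)}(r)\right)\ge\beta(r,\delta)$ (maximum over $i$ with $\mathcal R_i\neq\emptyset$), then all of $\mathcal R_{\tilde\imath}$ is removed: $\mathcal R=\mathcal R\setminus\mathcal R_{\tilde\imath}$, $\mathcal R_{\tilde\imath}=\emptyset$. The algorithm stops when all but one of the $\mathcal R_i$ are empty and outputs as $\hat\imath$ the index of the remaining set. If this has not happened when $r$ reaches $r_0=\frac2{\epsilon^2}\log\left(\frac{4\overline K}\delta\right)$ (rounded up to an integer), the algorithm stops and returns one of the empirical maximin actions, $\hat\imath\in\operatorname{argmax}_{i:\mathcal R_i\ne\emptyset}\min_{P\in\mathcal R_i}\hat\mu_P(r_0)$. **Constant $C_K$.** $C_K\le(\overline K)^2$ is a constant (independent of $\delta$ and $t$) for which the algorithm satisfies $\mathbb P_{\bm\mu}(\mu_{1,1}-\mu_{\hat\imath,1}\le\epsilon)\ge1-\delta$; when $\mu_{1,1}>\mu_{2,1}$ and $\mu_{i,1}<\mu_{i,2}$ for all $i$, it is $C_K=K\times\max_iK_i$. *)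

theory Defs
  imports "HOL-Probability.Probability"
begin

text \<open>Arm \<open>(i, j)\<close> is the \<open>j\<close>-th arm of action \<open>i\<close>; both indices start at 1, there are \<open>K\<close> actions
  and action \<open>i\<close> has \<open>n i\<close> arms.\<close>

type_synonym arm = "nat \<times> nat"

definition arms :: "nat \<Rightarrow> (nat \<Rightarrow> nat) \<Rightarrow> arm set" where
  "arms K n = (SIGMA i:{1..K}. {1..n i})"

definition num_arms :: "nat \<Rightarrow> (nat \<Rightarrow> nat) \<Rightarrow> nat" where
  "num_arms K n = (\<Sum>i=1..K. n i)"

text \<open>\<open>X P t\<close> is the outcome of the \<open>t\<close>-th draw of arm \<open>P\<close>, for \<open>t \<ge> 1\<close>. The whole table of
  potential outcomes lives on the sample space, whether or not a draw is actually made.\<close>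

definition bernoulli_rewards ::
  "'w measure \<Rightarrow> arm set \<Rightarrow> (arm \<Rightarrow> real) \<Rightarrow> (arm \<Rightarrow> nat \<Rightarrow> 'w \<Rightarrow> bool) \<Rightarrow> bool" where
  "bernoulli_rewards M A \<mu> X \<longleftrightarrow>
     (\<forall>P\<in>A. \<mu> P \<in> {0..1}) \<and>
     prob_space.indep_vars M (\<lambda>_. count_space UNIV) (\<lambda>(P, t). X P t) (A \<times> {1..}) \<and>
     (\<forall>P\<in>A. \<forall>t\<ge>1. distr M (count_space UNIV) (X P t) = measure_pmf (bernoulli_pmf (\<mu> P)))"

definition emp_mean :: "(arm \<Rightarrow> nat \<Rightarrow> 'w \<Rightarrow> bool) \<Rightarrow> nat \<Rightarrow> 'w \<Rightarrow> arm \<Rightarrow> real" where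
  "emp_mean X r \<omega> P = (\<Sum>t=1..r. of_bool (X P t \<omega>)) / real r"

text \<open>On \<open>{0..1}\<close> the conventions \<open>x / 0 = 0\<close> and \<open>ln 0 = 0\<close> give \<open>0 log 0 = 0\<close>. The only
  unintended values are those where the divergence is infinite (\<open>y \<in> {0, 1}\<close>, \<open>x \<noteq> y\<close>); they do
  not arise below, since the second argument is always the midpoint of the first and another
  point of \<open>{0..1}\<close>.\<close>

definition binary_kl :: "real \<Rightarrow> real \<Rightarrow> real" where
  "binary_kl x y = x * ln (x / y) + (1 - x) * ln ((1 - x) / (1 - y))"

definition midpoint_info :: "real \<Rightarrow> real \<Rightarrow> real" where
  "midpoint_info x y = binary_kl x ((x + y) / 2) + binary_kl y ((x + y) / 2)"

definition elim_fun :: "real \<Rightarrow> real \<Rightarrow> real" where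
  "elim_fun x y =
     (binary_kl x ((x + y) / 2) + binary_kl y ((x + y) / 2)) * (if x \<ge> y then 1 else 0)"

text \<open>The family of the active sets of the actions is encoded by the set \<open>R\<close> of all active arms:
  the active set of action \<open>i\<close> is \<open>row R i\<close>, and the actions with nonempty active set are
  \<open>fst ` R\<close>.\<close>

definition row :: "arm set \<Rightarrow> nat \<Rightarrow> arm set" where
  "row R i = {P \<in> R. fst P = i}"

definition row_min :: "(arm \<Rightarrow> real) \<Rightarrow> arm set \<Rightarrow> nat \<Rightarrow> real" where
  "row_min h R i = Min (h ` row R i)"

text \<open>One round maps an active set to a possible next one; it is a relation because ties in the
  argmax and argmin may be broken in any way. Here \<open>r\<close> is the index of the round, \<open>h\<close> gives the
  empirical means at that round, and \<open>b\<close> is the current value of the threshold.\<close>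

definition high_arm_elimination ::
  "(real \<Rightarrow> real \<Rightarrow> real) \<Rightarrow> real \<Rightarrow> nat \<Rightarrow> (arm \<Rightarrow> real) \<Rightarrow> arm set \<Rightarrow> arm set \<Rightarrow> bool" where
  "high_arm_elimination f b r h S S' \<longleftrightarrow>
     (if card S \<ge> 2 \<and> real r * f (Max (h ` S)) (Min (h ` S)) \<ge> b
      then \<exists>P. is_arg_max h (\<lambda>Q. Q \<in> S) P \<and> S' = S - {P}
      else S' = S)"

definition action_elimination ::
  "(real \<Rightarrow> real \<Rightarrow> real) \<Rightarrow> real \<Rightarrow> nat \<Rightarrow> (arm \<Rightarrow> real) \<Rightarrow> arm set \<Rightarrow> arm set \<Rightarrow> bool" where
  "action_elimination f b r h R R' \<longleftrightarrow>
     (\<exists>P. is_arg_min h (\<lambda>Q. Q \<in> R) P \<and>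
        R' = (if real r * f (Max (row_min h R ` (fst ` R - {fst P}))) (h P) \<ge> b
              then R - row R (fst P) else R))"

definition racing_round ::
  "(real \<Rightarrow> real \<Rightarrow> real) \<Rightarrow> real \<Rightarrow> nat \<Rightarrow> (arm \<Rightarrow> real) \<Rightarrow> arm set \<Rightarrow> arm set \<Rightarrow> bool" where
  "racing_round f b r h R R' \<longleftrightarrow>
     (\<exists>R1. (\<forall>i. high_arm_elimination f b r h (row R i) (row R1 i)) \<and>
           action_elimination f b r h R1 R')"

definition stopped :: "arm set \<Rightarrow> bool" where
  "stopped R \<longleftrightarrow> card (fst ` R) = 1"

definition max_rounds :: "nat \<Rightarrow> (nat \<Rightarrow> nat) \<Rightarrow> real \<Rightarrow> real \<Rightarrow> nat" where
  "max_rounds K n \<epsilon> \<delta> = nat \<lceil>2 / \<epsilon>\<^sup>2 * ln (4 * real (num_arms K n) / \<delta>)\<rceil>"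

text \<open>\<open>R r\<close> is the set of active arms after round \<open>r\<close>; it is frozen once the algorithm has stopped.
  Thus round \<open>r + 1\<close> draws exactly the arms in \<open>R r\<close>, provided that it takes place, and an arm
  active in round \<open>r\<close> has then been drawn \<open>r\<close> times.\<close>

definition racing_run ::
  "nat \<Rightarrow> (nat \<Rightarrow> nat) \<Rightarrow> (real \<Rightarrow> real \<Rightarrow> real) \<Rightarrow> (nat \<Rightarrow> real \<Rightarrow> real) \<Rightarrow> real \<Rightarrow> real \<Rightarrow>
   (nat \<Rightarrow> arm \<Rightarrow> real) \<Rightarrow> (nat \<Rightarrow> arm set) \<Rightarrow> bool" where
  "racing_run K n f \<beta> \<epsilon> \<delta> h R \<longleftrightarrow>
     R 0 = arms K n \<and>
     (\<forall>r. if r < max_rounds K n \<epsilon> \<delta> \<and> \<not> stopped (R r)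
          then racing_round f (\<beta> (Suc r) \<delta>) (Suc r) (h (Suc r)) (R r) (R (Suc r))
          else R (Suc r) = R r)"

definition recommended :: "(arm \<Rightarrow> real) \<Rightarrow> arm set \<Rightarrow> nat \<Rightarrow> bool" where
  "recommended h R i \<longleftrightarrow>
     (if stopped R then fst ` R = {i}
      else is_arg_max (row_min h R) (\<lambda>k. k \<in> fst ` R) i)"

text \<open>The algorithm as a random process on \<open>M\<close>: active sets \<open>R\<close> and output \<open>ihat\<close>, for an arbitrary
  measurable (possibly randomised) resolution of ties.\<close>

definition maximin_racing ::
  "'w measure \<Rightarrow> nat \<Rightarrow> (nat \<Rightarrow> nat) \<Rightarrow> (real \<Rightarrow> real \<Rightarrow> real) \<Rightarrow> (nat \<Rightarrow> real \<Rightarrow> real) \<Rightarrow> real \<Rightarrow> real \<Rightarrow>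
   (arm \<Rightarrow> nat \<Rightarrow> 'w \<Rightarrow> bool) \<Rightarrow> (nat \<Rightarrow> 'w \<Rightarrow> arm set) \<Rightarrow> ('w \<Rightarrow> nat) \<Rightarrow> bool" where
  "maximin_racing M K n f \<beta> \<epsilon> \<delta> X R ihat \<longleftrightarrow>
     (\<forall>r. R r \<in> measurable M (count_space (Pow (arms K n)))) \<and>
     ihat \<in> measurable M (count_space {1..K}) \<and>
     (\<forall>\<omega>\<in>space M.
        racing_run K n f \<beta> \<epsilon> \<delta> (\<lambda>r. emp_mean X r \<omega>) (\<lambda>r. R r \<omega>) \<and>
        recommended (emp_mean X (max_rounds K n \<epsilon> \<delta>) \<omega>) (R (max_rounds K n \<epsilon> \<delta>) \<omega>) (ihat \<omega>))"

definition num_draws ::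
  "nat \<Rightarrow> (nat \<Rightarrow> nat) \<Rightarrow> real \<Rightarrow> real \<Rightarrow> (nat \<Rightarrow> 'w \<Rightarrow> arm set) \<Rightarrow> arm \<Rightarrow> 'w \<Rightarrow> nat" where
  "num_draws K n \<epsilon> \<delta> R P \<omega> =
     card {r. r < max_rounds K n \<epsilon> \<delta> \<and> \<not> stopped (R r \<omega>) \<and> P \<in> R r \<omega>}"

definition log_threshold :: "real \<Rightarrow> nat \<Rightarrow> real \<Rightarrow> real" where
  "log_threshold C t \<delta> = ln (4 * C * real t / \<delta>)"

end

theory Submission
  imports Defs "HOL-Real_Asymp.Real_Asymp"
begin

text \<open>Write \<open>L = ln (1 / \<delta>)\<close>. The function \<open>I\<close> is at most 2, so no elimination can occur
  before round \<open>L / 4\<close>, and by Hoeffding's inequality the probability that some later empirical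
  mean is farther than \<open>\<eta>\<close> from its expectation tends to 0 as \<open>\<delta> \<rightarrow> 0\<close>. Since there are \<open>O(L)\<close>
  rounds at most, this event contributes \<open>o(L)\<close> to the expected number of draws.

  On the complementary event, with \<open>\<eta>\<close> small, action 1 stays active and every active action
  keeps an arm of minimal mean. Moreover, \<open>I\<close> is continuous and increases when its arguments are
  moved apart; therefore, if \<open>c < I(x, y)\<close> for one of the two pairs of means in the bound, then
  every round after \<open>L / c\<close> in which the arm is still active removes at least one arm.
  So the arm is drawn at most \<open>L / c\<close> times plus a constant.\<close>

section \<open>Midpoint information\<close>

text \<open>The negative of the binary entropy, in nats. \<open>midpoint_info\<close> is twice the
  Jensen-Shannon divergence of two Bernoulli laws, hence twice the gap in Jensen's inequality for
  this function at a midpoint; its analytic properties are read off from that form.\<close>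

definition bernoulli_negentropy :: "real \<Rightarrow> real" where
  "bernoulli_negentropy x = x * ln x + (1 - x) * ln (1 - x)"

lemma bernoulli_negentropy_flip: "bernoulli_negentropy (1 - x) = bernoulli_negentropy x"
  by (simp add: bernoulli_negentropy_def)

text \<open>At 0 the value is \<open>0 * ln 0 = 0\<close>, which agrees with the limit of
  \<open>x * ln x\<close> from the right. Including this endpoint matters because means and
  empirical means may equal 0 or 1.\<close>

lemma continuous_within_mult_ln:
  assumes "x \<ge> 0"
  shows "continuous (at x within {0..}) (\<lambda>x::real. x * ln x)"
proof (cases "x = 0")
  case True
  have "((\<lambda>x::real. x * ln x) \<longlongrightarrow> 0) (at_right 0)"
    by real_asymp
  then show ?thesis
    using True by (simp add: continuous_within at_within_Ici_at_right)
next
  case False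
  with assms have "isCont (\<lambda>x. x * ln x) x"
    by (auto intro!: isCont_mult isCont_ln)
  then show ?thesis
    by (rule continuous_at_imp_continuous_at_within)
qed

lemma continuous_on_bernoulli_negentropy: "continuous_on {0..1} bernoulli_negentropy"
proof -
  have mult_ln: "continuous_on {0..} (\<lambda>x::real. x * ln x)"
    using continuous_within_mult_ln by (auto simp: continuous_on_eq_continuous_within)
  have "continuous_on {0..1} (\<lambda>x::real. (1 - x) * ln (1 - x))"
    by (rule continuous_on_compose2[OF mult_ln, of _ "\<lambda>x. 1 - x"]) (auto intro!: continuous_intros)
  moreover have "continuous_on {0..1} (\<lambda>x::real. x * ln x)"
    by (rule continuous_on_subset[OF mult_ln]) auto
  ultimately show ?thesis
    unfolding bernoulli_negentropy_def by (rule continuous_on_add[rotated])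
qed

lemma has_real_derivative_bernoulli_negentropy:
  assumes "0 < x" "x < 1"
  shows "(bernoulli_negentropy has_real_derivative (ln x - ln (1 - x))) (at x)"
  unfolding bernoulli_negentropy_def
  using assms by (auto intro!: derivative_eq_intros)

section \<open>Monotonicity, bounds and stability of the midpoint information\<close>

lemma midpoint_info_commute: "midpoint_info x y = midpoint_info y x"
  by (simp add: midpoint_info_def add.commute)

lemma midpoint_info_self: "midpoint_info x x = 0"
  by (simp add: midpoint_info_def binary_kl_def)

lemma elim_fun_conv_midpoint_info: "elim_fun x y = (if x \<ge> y then midpoint_info x y else 0)"
  by (simp add: elim_fun_def midpoint_info_def)

text \<open>The logarithms of quotients split, and the weights of the two terms containing the
  midpoint add up to twice the midpoint; the same holds for the complements. Zero weights are
  treated apart because splitting the logarithm requires positive arguments.\<close>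

lemma midpoint_info_conv_negentropy:
  assumes "x \<in> {0..1}" "y \<in> {0..1}"
  shows "midpoint_info x y =
    bernoulli_negentropy x + bernoulli_negentropy y - 2 * bernoulli_negentropy ((x + y) / 2)"
proof -
  have split: "u * ln (u / ((u + v) / 2)) + v * ln (v / ((u + v) / 2)) =
      u * ln u + v * ln v - (u + v) * ln ((u + v) / 2)" if "u \<ge> 0" "v \<ge> 0" for u v :: real
  proof -
    have "w * ln (w / ((u + v) / 2)) = w * ln w - w * ln ((u + v) / 2)" if "w = u \<or> w = v" for w
    proof (cases "w = 0")
      case False
      with that \<open>u \<ge> 0\<close> \<open>v \<ge> 0\<close> have "w > 0" "(u + v) / 2 > 0"
        by auto
      then show ?thesis
        by (subst ln_div) (auto simp: right_diff_distrib)
    qed simp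
    then show ?thesis
      by (simp add: ring_distribs)
  qed
  have "1 - (x + y) / 2 = ((1 - x) + (1 - y)) / 2"
    by (simp add: field_simps)
  then show ?thesis
    using split[of x y] split[of "1 - x" "1 - y"] assms
    unfolding midpoint_info_def binary_kl_def bernoulli_negentropy_def
    by (simp add: field_simps)
qed

text \<open>The derivative in the first argument is the difference of the log-odds at
  \<open>u\<close> and at the midpoint \<open>(u + y) / 2\<close>, which is nonnegative since the
  midpoint does not exceed \<open>u\<close>. The log-odds blow up at 0 and 1, so the derivative is
  used in the open interval only and continuity covers the ends. The function \<open>g\<close> drops
  the summand that depends on \<open>y\<close> alone.\<close>

lemma midpoint_info_mono_left:
  assumes "0 \<le> y" "y \<le> x" "x \<le> x'" "x' \<le> 1"
  shows "midpoint_info x y \<le> midpoint_info x' y"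
proof -
  define g where "g = (\<lambda>u. bernoulli_negentropy u - 2 * bernoulli_negentropy ((u + y) / 2))"
  have "g x \<le> g x'"
  proof (cases "x = x'")
    case False
    show ?thesis
    proof (rule DERIV_nonneg_imp_increasing_open[of x x' g])
      show "x \<le> x'" by fact
      show "continuous_on {x..x'} g"
        unfolding g_def
        by (intro continuous_intros continuous_on_subset[OF continuous_on_bernoulli_negentropy]
            continuous_on_compose2[OF continuous_on_bernoulli_negentropy])
          (use assms in auto)
      fix u assume u: "x < u" "u < x'"
      let ?m = "(u + y) / 2"
      have m: "0 < ?m" "?m \<le> u" "u < 1"
        using u assms by auto
      have "(g has_real_derivative (ln u - ln (1 - u)) - 2 * ((ln ?m - ln (1 - ?m)) * (1 / 2))) (at u)"
        unfolding g_def
      proof (intro DERIV_diff DERIV_cmult DERIV_chain2[where f = bernoulli_negentropy])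
        show "(bernoulli_negentropy has_real_derivative ln u - ln (1 - u)) (at u)"
          and "(bernoulli_negentropy has_real_derivative ln ?m - ln (1 - ?m)) (at ?m)"
          using m by (auto intro!: has_real_derivative_bernoulli_negentropy)
        show "((\<lambda>u. (u + y) / 2) has_real_derivative 1 / 2) (at u)"
          by (auto intro!: derivative_eq_intros)
      qed
      moreover have "ln ?m \<le> ln u" "ln (1 - u) \<le> ln (1 - ?m)"
        using m by auto
      ultimately show "\<exists>d. (g has_real_derivative d) (at u) \<and> 0 \<le> d"
        by (intro exI[of _ "(ln u - ln (1 - u)) - 2 * ((ln ?m - ln (1 - ?m)) * (1 / 2))"]) auto
    qed
  qed simp
  then show ?thesis
    using assms by (simp add: midpoint_info_conv_negentropy g_def)
qed

text \<open>Exchanging the outcomes 0 and 1 changes no divergence. This symmetry carries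
  monotonicity from the first argument to the second.\<close>

lemma midpoint_info_flip:
  assumes "x \<in> {0..1}" "y \<in> {0..1}"
  shows "midpoint_info (1 - x) (1 - y) = midpoint_info x y"
proof -
  have "(1 - x + (1 - y)) / 2 = 1 - (x + y) / 2"
    by (simp add: field_simps)
  then have "bernoulli_negentropy ((1 - x + (1 - y)) / 2) = bernoulli_negentropy ((x + y) / 2)"
    by (simp only: bernoulli_negentropy_flip)
  moreover have "1 - x \<in> {0..1}" "1 - y \<in> {0..1}"
    using assms by auto
  ultimately show ?thesis
    using assms by (simp only: midpoint_info_conv_negentropy bernoulli_negentropy_flip)
qed

lemma midpoint_info_antimono_right:
  assumes "0 \<le> y'" "y' \<le> y" "y \<le> x" "x \<le> 1"
  shows "midpoint_info x y \<le> midpoint_info x y'"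
proof -
  have "midpoint_info (1 - y) (1 - x) \<le> midpoint_info (1 - y') (1 - x)"
    using assms by (intro midpoint_info_mono_left) auto
  then show ?thesis
    using assms by (simp add: midpoint_info_flip midpoint_info_commute)
qed

lemma midpoint_info_spread:
  assumes "0 \<le> y'" "y' \<le> y" "y \<le> x" "x \<le> x'" "x' \<le> 1"
  shows "midpoint_info x y \<le> midpoint_info x' y'"
  using midpoint_info_mono_left[of y x x'] midpoint_info_antimono_right[of y' y x'] assms by linarith

text \<open>The pair \<open>(1, 0)\<close> is the most spread one and gives \<open>2 * ln 2\<close>.
  The rounder bound 2 controls both the rounds before the first elimination and the size of the
  progress rates.\<close>

lemma midpoint_info_le:
  assumes "0 \<le> y" "y \<le> x" "x \<le> 1"
  shows "midpoint_info x y \<le> 2"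
proof -
  have "midpoint_info x y \<le> midpoint_info 1 0"
    using assms by (intro midpoint_info_spread) auto
  also have "\<dots> = 2 * ln 2"
    by (simp add: midpoint_info_def binary_kl_def)
  also have "\<dots> \<le> 2"
    using ln_le_minus_one[of 2] by simp
  finally show ?thesis .
qed

lemma elim_fun_le: "x \<in> {0..1} \<Longrightarrow> y \<in> {0..1} \<Longrightarrow> elim_fun x y \<le> 2"
  by (simp add: elim_fun_conv_midpoint_info midpoint_info_le)

text \<open>It suffices to move \<open>a\<close> and \<open>b\<close> towards each other by a small
  \<open>e\<close>: continuity keeps the value at \<open>(a - e, b + e)\<close> above
  \<open>c\<close>, and every admissible pair \<open>(x, y)\<close> is at least as spread as this
  one.\<close>

lemma midpoint_info_robust:
  assumes "0 \<le> b" "b < a" "a \<le> 1" "c < midpoint_info a b"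
  obtains \<eta> where "\<eta> > 0"
    "\<And>x y. \<lbrakk>x \<in> {0..1}; y \<in> {0..1}; a - \<eta> \<le> x; y \<le> b + \<eta>\<rbrakk> \<Longrightarrow> y \<le> x \<and> c < midpoint_info x y"
proof -
  \<comment> \<open>The midpoint of \<open>a - e\<close> and \<open>b + e\<close> does not depend on
    \<open>e\<close>, so the last term is constant.\<close>
  define G where "G = (\<lambda>e. bernoulli_negentropy (a - e) + bernoulli_negentropy (b + e)
    - 2 * bernoulli_negentropy ((a + b) / 2))"
  have G: "G e = midpoint_info (a - e) (b + e)" if "0 \<le> e" "e \<le> (a - b) / 2" for e
    using that assms by (subst midpoint_info_conv_negentropy) (auto simp: G_def)
  have "continuous_on {0..(a - b) / 2} G"
    unfolding G_def
    by (intro continuous_intros continuous_on_compose2[OF continuous_on_bernoulli_negentropy])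
      (use assms in \<open>auto simp: field_simps\<close>)
  then have "(G \<longlongrightarrow> G 0) (at_right 0)"
    using assms by (auto simp: continuous_on_def at_within_Icc_at_right dest: bspec[of _ _ 0])
  moreover have "c < G 0"
    using assms by (simp add: G)
  ultimately have "\<forall>\<^sub>F e in at_right 0. c < G e"
    by (rule order_tendstoD)
  moreover have "\<forall>\<^sub>F e in at_right 0. e < (a - b) / 2"
    using assms by (intro eventually_at_rightI[of 0 "(a - b) / 2"]) auto
  moreover have "\<forall>\<^sub>F e in at_right 0. 0 < (e::real)"
    by (simp add: eventually_at_right_less)
  ultimately have "\<forall>\<^sub>F e in at_right 0. 0 < e \<and> e < (a - b) / 2 \<and> c < G e"
    by eventually_elim auto
  then obtain e where e: "0 < e" "e < (a - b) / 2" "c < G e"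
    using eventually_happens trivial_limit_at_right_real by blast
  show thesis
  proof (rule that[of e])
    fix x y assume xy: "x \<in> {0..1}" "y \<in> {0..1}" "a - e \<le> x" "y \<le> b + e"
    have "midpoint_info (a - e) (b + e) \<le> midpoint_info x y"
      using xy e by (intro midpoint_info_spread) auto
    then show "y \<le> x \<and> c < midpoint_info x y"
      using xy e G[of e] by auto
  qed (fact e)
qed

section \<open>Dynamics of the race\<close>

lemma finite_arms [simp]: "finite (arms K n)"
  by (simp add: arms_def)

lemma card_arms: "card (arms K n) = num_arms K n"
  by (simp add: arms_def num_arms_def)

lemma row_subset: "row R i \<subseteq> R"
  by (auto simp: row_def)

lemma row_nonempty_iff: "row R i \<noteq> {} \<longleftrightarrow> i \<in> fst ` R"
  by (force simp: row_def)

lemma in_row_iff: "P \<in> row R i \<longleftrightarrow> P \<in> R \<and> fst P = i"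
  by (auto simp: row_def)

lemma is_arg_min_in_iff: "is_arg_min h (\<lambda>Q. Q \<in> R) P \<longleftrightarrow> P \<in> R \<and> (\<forall>Q\<in>R. h P \<le> h Q)"
  for h :: "'a \<Rightarrow> real"
  unfolding is_arg_min_def by (meson not_le)

lemma is_arg_max_in_iff: "is_arg_max h (\<lambda>Q. Q \<in> R) P \<longleftrightarrow> P \<in> R \<and> (\<forall>Q\<in>R. h Q \<le> h P)"
  for h :: "'a \<Rightarrow> real"
  unfolding is_arg_max_def by (meson not_le)

lemma rows_subsetD: "(\<And>i. row R i \<subseteq> row R' i) \<Longrightarrow> R \<subseteq> R'"
  by (auto simp: row_def)

lemma rows_eqD: "(\<And>i. row R i = row R' i) \<Longrightarrow> R = R'"
  by (auto simp: row_def set_eq_iff)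

lemma high_arm_elimination_subset: "high_arm_elimination f b r h S S' \<Longrightarrow> S' \<subseteq> S"
  by (auto simp: high_arm_elimination_def split: if_splits)

text \<open>Only one arm is removed, and only from a set of at least two. Thus the high arm phase
  never empties an action, and the stopping condition is the same before and after it.\<close>

lemma high_arm_elimination_empty_iff:
  assumes "high_arm_elimination f b r h S S'"
  shows "S' = {} \<longleftrightarrow> S = {}"
proof -
  have "S - {P} \<noteq> {}" if "card S \<ge> 2" for P
  proof
    assume "S - {P} = {}"
    then have "card S \<le> card {P}"
      by (intro card_mono) auto
    then show False
      using that by simp
  qed
  moreover have "S \<noteq> {}" if "card S \<ge> 2"
    using that by auto
  ultimately show ?thesis
    using assms by (auto simp: high_arm_elimination_def split: if_splits)
qed

lemma high_arm_eliminations_subset: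
  "(\<And>i. high_arm_elimination f b r h (row R i) (row R1 i)) \<Longrightarrow> R1 \<subseteq> R"
  by (rule rows_subsetD) (rule high_arm_elimination_subset)

lemma high_arm_eliminations_actions:
  assumes "\<And>i. high_arm_elimination f b r h (row R i) (row R1 i)"
  shows "fst ` R1 = fst ` R"
proof -
  have "i \<in> fst ` R1 \<longleftrightarrow> i \<in> fst ` R" for i
    using high_arm_elimination_empty_iff[OF assms[of i]]
    by (simp only: row_nonempty_iff[symmetric])
  then show ?thesis
    by blast
qed

lemma action_elimination_subset: "action_elimination f b r h R R' \<Longrightarrow> R' \<subseteq> R"
  by (auto simp: action_elimination_def split: if_splits)

lemma racing_round_subset: "racing_round f b r h R R' \<Longrightarrow> R' \<subseteq> R"
  unfolding racing_round_def
  using high_arm_eliminations_subset action_elimination_subset by (metis subset_trans)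

lemma elim_fun_image_le:
  assumes "finite R" "\<forall>P\<in>R. h P \<in> {0..1}" "S \<subseteq> R" "S \<noteq> {}"
  shows "elim_fun (Max (h ` S)) (Min (h ` S)) \<le> 2"
proof -
  have "finite S"
    using assms finite_subset by blast
  then have "Max (h ` S) \<in> h ` S" "Min (h ` S) \<in> h ` S"
    using assms by auto
  then show ?thesis
    using assms(2,3) by (intro elim_fun_le) (metis imageE subsetD)+
qed

text \<open>Both tests evaluate \<open>elim_fun\<close> at points of the unit interval, where it is
  at most 2, so neither can reach a threshold above \<open>2 * r\<close>. Two active actions are
  required so that the maximum in the action test ranges over a nonempty set and is an attained
  value.\<close>

lemma racing_round_no_elimination:
  assumes "racing_round elim_fun b r h R R'"
    and "finite R" "\<forall>P\<in>R. h P \<in> {0..1}" "card (fst ` R) \<ge> 2" and b: "real r * 2 < b"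
  shows "R' = R"
proof -
  obtain R1 where R1: "\<And>i. high_arm_elimination elim_fun b r h (row R i) (row R1 i)"
    "action_elimination elim_fun b r h R1 R'"
    using assms(1) by (auto simp: racing_round_def)
  have below: "real r * elim_fun x y < b" if "elim_fun x y \<le> 2" for x y
    using b mult_left_mono[OF that, of "real r"] by simp
  have "row R1 i = row R i" for i
  proof (cases "row R i = {}")
    case True
    then show ?thesis
      using high_arm_elimination_subset[OF R1(1)[of i]] by auto
  next
    case False
    then show ?thesis
      using R1(1)[of i] below[OF elim_fun_image_le[OF assms(2,3) row_subset False]]
      by (auto simp: high_arm_elimination_def)
  qed
  then have "R1 = R"
    by (rule rows_eqD)
  moreover have "\<not> real r * elim_fun (Max (row_min h R ` (fst ` R - {fst P}))) (h P) \<ge> b"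
    if "P \<in> R" for P
  proof -
    have "fst ` R - {fst P} \<noteq> {}"
      using assms(4) card_mono[of "{fst P}" "fst ` R"] by fastforce
    then have "Max (row_min h R ` (fst ` R - {fst P})) \<in> row_min h R ` (fst ` R - {fst P})"
      using assms(2) by (intro Max_in) auto
    then obtain k where k: "k \<in> fst ` R" "Max (row_min h R ` (fst ` R - {fst P})) = row_min h R k"
      by blast
    have "row_min h R k \<in> h ` row R k"
      unfolding row_min_def using k(1) assms(2) finite_subset[OF row_subset]
      by (intro Min_in) (auto simp: row_def)
    then have "row_min h R k \<in> {0..1}"
      using assms(3) row_subset by (metis imageE subsetD)
    then have "elim_fun (row_min h R k) (h P) \<le> 2"
      using that assms(3) by (intro elim_fun_le) auto
    then show ?thesis
      using below k(2) by (simp add: not_le)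
  qed
  ultimately show ?thesis
    using R1(2) by (auto simp: action_elimination_def is_arg_min_in_iff)
qed

section \<open>Accurate empirical means and separated true means\<close>

definition accurate :: "arm set \<Rightarrow> (arm \<Rightarrow> real) \<Rightarrow> real \<Rightarrow> (arm \<Rightarrow> real) \<Rightarrow> bool" where
  "accurate A \<mu> \<eta> h \<longleftrightarrow> (\<forall>P\<in>A. h P \<in> {0..1} \<and> \<bar>h P - \<mu> P\<bar> < \<eta>)"

text \<open>Twice the accuracy is the gap at which empirical means must be ordered like the true
  ones. Only distinct means are constrained, so arms with equal means are allowed and their
  empirical order is left open.\<close>

definition separated :: "arm set \<Rightarrow> (arm \<Rightarrow> real) \<Rightarrow> real \<Rightarrow> bool" where
  "separated A \<mu> \<eta> \<longleftrightarrow> (\<forall>P\<in>A. \<forall>Q\<in>A. \<mu> P < \<mu> Q \<longrightarrow> \<mu> P + 2 * \<eta> \<le> \<mu> Q)"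

lemma accurate_separated_less:
  assumes "accurate A \<mu> \<eta> h" "separated A \<mu> \<eta>" "P \<in> A" "Q \<in> A" "\<mu> P < \<mu> Q"
  shows "h P < h Q"
proof -
  have "\<bar>h P - \<mu> P\<bar> < \<eta>" "\<bar>h Q - \<mu> Q\<bar> < \<eta>" "\<mu> P + 2 * \<eta> \<le> \<mu> Q"
    using assms by (auto simp: accurate_def separated_def)
  then show ?thesis
    by linarith
qed

lemma separated_mono: "separated A \<mu> \<eta> \<Longrightarrow> \<eta>' \<le> \<eta> \<Longrightarrow> separated A \<mu> \<eta>'"
  unfolding separated_def by fastforce

text \<open>Half of the smallest positive gap works. The inserted 1 keeps the minimum well defined
  when all means coincide.\<close>

lemma separated_exists:
  assumes "finite A"
  obtains \<eta> where "\<eta> > 0" "separated A \<mu> \<eta>"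
proof -
  define D where "D = (\<lambda>(P, Q). (\<mu> Q - \<mu> P) / 2) ` {(P, Q) \<in> A \<times> A. \<mu> P < \<mu> Q}"
  have "finite {(P, Q) \<in> A \<times> A. \<mu> P < \<mu> Q}"
    by (rule finite_subset[of _ "A \<times> A"]) (use assms in auto)
  then have fin: "finite (insert 1 D)"
    by (simp add: D_def)
  have "\<forall>d\<in>insert 1 D. d > 0"
    by (auto simp: D_def)
  then have "Min (insert 1 D) > 0"
    using fin by simp
  moreover have "separated A \<mu> (Min (insert 1 D))"
    unfolding separated_def
  proof (intro ballI impI)
    fix P Q assume "P \<in> A" "Q \<in> A" "\<mu> P < \<mu> Q"
    then have "(\<mu> Q - \<mu> P) / 2 \<in> D"
      by (force simp: D_def)
    then have "Min (insert 1 D) \<le> (\<mu> Q - \<mu> P) / 2"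
      using fin by (intro Min_le) auto
    then show "\<mu> P + 2 * Min (insert 1 D) \<le> \<mu> Q"
      by simp
  qed
  ultimately show thesis
    by (rule that)
qed

section \<open>Bandit instances with a unique maximin action\<close>

locale maximin_means =
  fixes K :: nat and n :: "nat \<Rightarrow> nat" and \<mu> :: "arm \<Rightarrow> real"
  assumes two_actions: "K \<ge> 2"
    and arms_nonempty: "\<And>i. i \<in> {1..K} \<Longrightarrow> n i \<ge> 1"
    and mean_range: "\<And>P. P \<in> arms K n \<Longrightarrow> \<mu> P \<in> {0..1}"
    and mean_mono: "\<And>i. i \<in> {1..K} \<Longrightarrow> mono_on {1..n i} (\<lambda>j. \<mu> (i, j))"
    and mean_antimono: "antimono_on {1..K} (\<lambda>i. \<mu> (i, 1))"
    and mean_gap: "\<mu> (2, 1) < \<mu> (1, 1)"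
begin

lemma first_arm: "i \<in> {1..K} \<Longrightarrow> (i, 1) \<in> arms K n"
  using arms_nonempty by (auto simp: arms_def)

lemma first_arm_le:
  assumes "P \<in> arms K n"
  shows "\<mu> (fst P, 1) \<le> \<mu> P"
proof -
  obtain i j where "P = (i, j)" "i \<in> {1..K}" "j \<in> {1..n i}"
    using assms by (auto simp: arms_def)
  then show ?thesis
    using mono_onD[OF mean_mono, of i 1 j] by auto
qed

lemma later_action_le: "i \<in> {1..K} \<Longrightarrow> i \<noteq> 1 \<Longrightarrow> \<mu> (i, 1) \<le> \<mu> (2, 1)"
  using monotone_onD[OF mean_antimono, of 2 i] two_actions by auto

text \<open>The invariant of a run with accurate means. The witness is only required to have the
  minimal mean of its action, because \<open>(i, 1)\<close> itself may be eliminated when another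
  arm ties with it.\<close>

definition sound_arms :: "arm set \<Rightarrow> bool" where
  "sound_arms R \<longleftrightarrow> R \<subseteq> arms K n \<and> 1 \<in> fst ` R \<and> (\<forall>i\<in>fst ` R. \<exists>P\<in>row R i. \<mu> P = \<mu> (i, 1))"

lemma sound_arms_finite: "sound_arms R \<Longrightarrow> finite R"
  unfolding sound_arms_def using finite_subset finite_arms by blast

lemma sound_arms_action: "sound_arms R \<Longrightarrow> i \<in> fst ` R \<Longrightarrow> i \<in> {1..K}"
  by (auto simp: sound_arms_def arms_def)

lemma sound_arms_witness:
  assumes "sound_arms R" "i \<in> fst ` R"
  obtains P where "P \<in> R" "P \<in> arms K n" "fst P = i" "\<mu> P = \<mu> (i, 1)"
  using assms unfolding sound_arms_def in_row_iff Bex_def by blast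

lemma fst_arms: "fst ` arms K n = {1..K}"
  using first_arm by (force simp: arms_def)

lemma sound_arms_arms: "sound_arms (arms K n)"
  unfolding sound_arms_def fst_arms using two_actions first_arm by (force simp: in_row_iff)

lemma sound_not_stopped:
  assumes "sound_arms R" "\<not> stopped R"
  obtains i where "i \<in> fst ` R" "i \<noteq> 1"
proof -
  have "fst ` R \<noteq> {1}"
    using assms(2) by (auto simp: stopped_def)
  then show thesis
    using assms(1) that by (auto simp: sound_arms_def)
qed

section \<open>One round under accurate empirical means\<close>

context
  fixes h :: "arm \<Rightarrow> real" and \<eta> :: real
  assumes acc: "accurate (arms K n) \<mu> \<eta> h" and sep: "separated (arms K n) \<mu> \<eta>"
begin

text \<open>Suppose that the removed arm \<open>P\<close> is the chosen witness of its action. It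
  maximises the empirical mean there, so by separation no other active arm \<open>Q\<close> of the
  action has a larger true mean. Since \<open>P\<close> has minimal mean, so does \<open>Q\<close>,
  and such a \<open>Q\<close> exists because the row had two arms.\<close>

lemma sound_high_arm_eliminations:
  assumes sound: "sound_arms R"
    and high: "\<And>i. high_arm_elimination f b r h (row R i) (row R1 i)"
  shows "sound_arms R1"
proof -
  have sub: "R1 \<subseteq> R" and fst: "fst ` R1 = fst ` R"
    using high_arm_eliminations_subset[OF high] high_arm_eliminations_actions[OF high] by auto
  have "\<exists>P\<in>row R1 i. \<mu> P = \<mu> (i, 1)" if "i \<in> fst ` R" for i
  proof -
    obtain P where P: "P \<in> R" "P \<in> arms K n" "fst P = i" "\<mu> P = \<mu> (i, 1)"
      using sound \<open>i \<in> fst ` R\<close> by (rule sound_arms_witness)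
    show ?thesis
    proof (cases "P \<in> R1")
      case False
      with P have "P \<in> row R i" "P \<notin> row R1 i"
        by (auto simp: in_row_iff)
      then have card: "card (row R i) \<ge> 2" and max: "is_arg_max h (\<lambda>Q. Q \<in> row R i) P"
        and eq: "row R1 i = row R i - {P}"
        using high[of i] by (auto simp: high_arm_elimination_def split: if_splits)
      have "row R i \<noteq> {P}"
        using card by auto
      then obtain Q where Q: "Q \<in> row R i" "Q \<noteq> P"
        using \<open>P \<in> row R i\<close> by auto
      then have QA: "Q \<in> arms K n" "fst Q = i"
        using sound by (auto simp: in_row_iff sound_arms_def)
      have "\<not> h P < h Q"
        using max Q by (auto simp: is_arg_max_in_iff not_less simp del: split_paired_All)
      then have "\<not> \<mu> P < \<mu> Q"
        using accurate_separated_less[OF acc sep] P QA by blast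
      then have "\<mu> Q = \<mu> (i, 1)"
        using first_arm_le[OF QA(1)] QA P by auto
      then show ?thesis
        using eq Q by auto
    qed (use P in \<open>auto simp: in_row_iff\<close>)
  qed
  then show ?thesis
    using sound sub fst by (auto simp: sound_arms_def)
qed

text \<open>The witness of an action other than 1 has mean at most \<open>\<mu> (2, 1)\<close>,
  strictly below every mean in action 1, and accuracy preserves this order. Hence action elimination
  never hits action 1.\<close>

lemma arg_min_other_action:
  assumes sound: "sound_arms R" and min: "is_arg_min h (\<lambda>Q. Q \<in> R) P" and i: "i \<in> fst ` R" "i \<noteq> 1"
  shows "fst P \<noteq> 1"
proof
  assume P1: "fst P = 1"
  have P: "P \<in> R" "P \<in> arms K n"
    using min sound by (auto simp: is_arg_min_in_iff sound_arms_def)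
  obtain Q where Q: "Q \<in> R" "Q \<in> arms K n" "fst Q = i" "\<mu> Q = \<mu> (i, 1)"
    using sound i(1) by (rule sound_arms_witness)
  have "\<mu> Q < \<mu> P"
    using later_action_le[OF sound_arms_action[OF sound i(1)] i(2)] first_arm_le[OF P(2)] mean_gap
      Q P1 by auto
  then have "h Q < h P"
    using accurate_separated_less[OF acc sep] P Q by blast
  then show False
    using min Q by (auto simp: is_arg_min_in_iff)
qed

lemma sound_action_elimination:
  assumes sound: "sound_arms R" and "\<not> stopped R" and "action_elimination f b r h R R'"
  shows "sound_arms R'"
proof -
  obtain P where P: "is_arg_min h (\<lambda>Q. Q \<in> R) P" and R': "R' = R \<or> R' = R - row R (fst P)"
    using assms(3) unfolding action_elimination_def by metis
  obtain i where "i \<in> fst ` R" "i \<noteq> 1"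
    using sound_not_stopped[OF sound \<open>\<not> stopped R\<close>] .
  then have "fst P \<noteq> 1"
    using arg_min_other_action[OF sound P] by blast
  then show ?thesis
    using R'
  proof (elim disjE)
    assume R': "R' = R - row R (fst P)" and "fst P \<noteq> 1"
    have rows: "row R' i = row R i" "fst P \<noteq> i" if "i \<in> fst ` R'" for i
      using that by (auto simp: R' row_def)
    have "1 \<in> fst ` R'"
      using sound \<open>fst P \<noteq> 1\<close> by (force simp: sound_arms_def R' row_def)
    moreover have "fst ` R' \<subseteq> fst ` R" "R' \<subseteq> R"
      by (auto simp: R')
    ultimately show ?thesis
      using sound rows unfolding sound_arms_def by blast
  qed (use sound in simp)
qed

lemma sound_racing_round:
  assumes "sound_arms R" "\<not> stopped R" "racing_round f b r h R R'"
  shows "sound_arms R'"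
proof -
  obtain R1 where R1: "\<And>i. high_arm_elimination f b r h (row R i) (row R1 i)"
    "action_elimination f b r h R1 R'"
    using assms(3) by (auto simp: racing_round_def)
  have "\<not> stopped R1"
    using assms(2) high_arm_eliminations_actions[OF R1(1)] by (simp add: stopped_def)
  then show ?thesis
    using sound_high_arm_eliminations[OF assms(1) R1(1)] sound_action_elimination R1(2) by blast
qed

text \<open>The row of \<open>P\<close> also contains a witness of minimal mean. Its empirical
  maximum is at least that of \<open>P\<close> and its minimum at most that of the witness, so
  \<open>robust\<close> applies and the high arm test succeeds.\<close>

lemma high_arm_progress:
  assumes sound: "sound_arms R" and round: "racing_round elim_fun b r h R R'"
    and P: "P \<in> R" "\<mu> (fst P, 1) < \<mu> P"
    and robust: "\<And>x y. \<lbrakk>x \<in> {0..1}; y \<in> {0..1}; \<mu> P - \<eta> \<le> x; y \<le> \<mu> (fst P, 1) + \<eta>\<rbrakk>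
      \<Longrightarrow> y \<le> x \<and> c < midpoint_info x y"
    and b: "b \<le> real r * c"
  shows "R' \<noteq> R"
proof -
  obtain R1 where R1: "\<And>i. high_arm_elimination elim_fun b r h (row R i) (row R1 i)"
    "action_elimination elim_fun b r h R1 R'"
    using round by (auto simp: racing_round_def)
  let ?S = "row R (fst P)"
  have fin: "finite ?S"
    using sound_arms_finite[OF sound] finite_subset row_subset by blast
  have range: "h Q \<in> {0..1}" "\<bar>h Q - \<mu> Q\<bar> < \<eta>" if "Q \<in> ?S" for Q
    using acc sound that by (auto simp: accurate_def sound_arms_def row_def)
  obtain Q where Q: "Q \<in> R" "fst Q = fst P" "\<mu> Q = \<mu> (fst P, 1)"
    using sound_arms_witness[OF sound, of "fst P"] P(1) by blast
  have S: "P \<in> ?S" "Q \<in> ?S" "P \<noteq> Q"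
    using P Q by (auto simp: in_row_iff)
  have "card {P, Q} \<le> card ?S"
    using S fin by (intro card_mono) auto
  then have card: "card ?S \<ge> 2"
    using S by simp
  have "Max (h ` ?S) \<in> h ` ?S" "Min (h ` ?S) \<in> h ` ?S"
    using fin S by (blast intro: Max_in Min_in)+
  then have "Max (h ` ?S) \<in> {0..1}" "Min (h ` ?S) \<in> {0..1}"
    using range(1) by (metis imageE)+
  moreover have "h P \<le> Max (h ` ?S)" "Min (h ` ?S) \<le> h Q"
    using fin S by auto
  ultimately have "Min (h ` ?S) \<le> Max (h ` ?S) \<and> c < midpoint_info (Max (h ` ?S)) (Min (h ` ?S))"
    using range(2)[OF S(1)] range(2)[OF S(2)] Q(3) by (intro robust) auto
  then have "c \<le> elim_fun (Max (h ` ?S)) (Min (h ` ?S))"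
    by (simp add: elim_fun_conv_midpoint_info)
  then have "b \<le> real r * elim_fun (Max (h ` ?S)) (Min (h ` ?S))"
    using b mult_left_mono[of c _ "real r"] by fastforce
  \<comment> \<open>The removed arm maximises the empirical mean and need not be \<open>P\<close>;
    any removal counts as progress.\<close>
  then obtain P' where "is_arg_max h (\<lambda>Q. Q \<in> ?S) P'" "row R1 (fst P) = ?S - {P'}"
    using R1(1)[of "fst P"] card by (auto simp: high_arm_elimination_def)
  then have "P' \<in> R" "P' \<notin> R1"
    unfolding is_arg_max_in_iff by (metis in_row_iff, metis Diff_iff in_row_iff insertI1)
  then show ?thesis
    using action_elimination_subset[OF R1(2)] by auto
qed

text \<open>The empirical minimiser \<open>P\<close> lies outside action 1 and, compared with the
  witness of \<open>i\<close>, is at most \<open>m + \<eta>\<close>. Action 1 therefore takes part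
  in the maximum, which is at least \<open>\<mu> (1, 1) - \<eta>\<close>, and the test succeeds. The
  removed action is that of \<open>P\<close>, possibly different from \<open>i\<close>. All of this
  takes place in the set \<open>R1\<close> left by the high arm phase, which is sound as
  well.\<close>

lemma action_progress:
  assumes sound: "sound_arms R" and round: "racing_round elim_fun b r h R R'"
    and i: "i \<in> fst ` R" "i \<noteq> 1" "\<mu> (i, 1) \<le> m"
    and robust: "\<And>x y. \<lbrakk>x \<in> {0..1}; y \<in> {0..1}; \<mu> (1, 1) - \<eta> \<le> x; y \<le> m + \<eta>\<rbrakk>
      \<Longrightarrow> y \<le> x \<and> c < midpoint_info x y"
    and b: "b \<le> real r * c"
  shows "R' \<noteq> R"
proof -
  obtain R1 where R1: "\<And>i. high_arm_elimination elim_fun b r h (row R i) (row R1 i)"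
    "action_elimination elim_fun b r h R1 R'"
    using round by (auto simp: racing_round_def)
  have sound1: "sound_arms R1"
    using sound_high_arm_eliminations[OF sound R1(1)] .
  have fst: "fst ` R1 = fst ` R" and sub: "R1 \<subseteq> R"
    using high_arm_eliminations_actions[OF R1(1)] high_arm_eliminations_subset[OF R1(1)] by auto
  have fin: "finite R1" and fin_row: "finite (row R1 k)" for k
    using sound_arms_finite[OF sound1] finite_subset row_subset by blast+
  have range: "h Q \<in> {0..1}" "\<bar>h Q - \<mu> Q\<bar> < \<eta>" "Q \<in> arms K n" if "Q \<in> R1" for Q
    using acc sound1 that by (auto simp: accurate_def sound_arms_def)
  obtain P where P: "is_arg_min h (\<lambda>Q. Q \<in> R1) P"
    and R': "R' = (if real r * elim_fun (Max (row_min h R1 ` (fst ` R1 - {fst P}))) (h P) \<ge> b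
              then R1 - row R1 (fst P) else R1)"
    using R1(2) unfolding action_elimination_def by blast
  have PR: "P \<in> R1" and P_le: "\<And>Q. Q \<in> R1 \<Longrightarrow> h P \<le> h Q"
    using P by (auto simp: is_arg_min_in_iff)
  have "fst P \<noteq> 1"
    using arg_min_other_action[OF sound1 P] i fst by blast
  let ?M = "Max (row_min h R1 ` (fst ` R1 - {fst P}))"
  have row_min_in: "row_min h R1 k \<in> h ` row R1 k" if "k \<in> fst ` R1" for k
    unfolding row_min_def using fin_row that by (intro Min_in) (auto simp: row_def)
  have one: "1 \<in> fst ` R1 - {fst P}"
    using sound1 \<open>fst P \<noteq> 1\<close> by (auto simp: sound_arms_def)
  have "?M \<in> row_min h R1 ` (fst ` R1 - {fst P})"
    using fin one by (intro Max_in) auto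
  then obtain k where "k \<in> fst ` R1" "?M = row_min h R1 k"
    by blast
  then have "?M \<in> {0..1}"
    using row_min_in[of k] range(1) by (metis imageE in_row_iff)
  moreover have "\<mu> (1, 1) - \<eta> \<le> row_min h R1 1"
  proof -
    obtain Q where Q: "Q \<in> row R1 1" "row_min h R1 1 = h Q"
      using row_min_in[of 1] one by blast
    then show ?thesis
      using range(2,3)[of Q] first_arm_le[of Q] by (auto simp: in_row_iff)
  qed
  moreover have "row_min h R1 1 \<le> ?M"
    using fin one by (intro Max_ge) auto
  moreover have "h P \<le> m + \<eta>"
  proof -
    obtain Q where Q: "Q \<in> R1" "\<mu> Q = \<mu> (i, 1)"
      using sound_arms_witness[OF sound1, of i] i(1) fst by blast
    then show ?thesis
      using P_le[of Q] range(2)[of Q] i(3) by auto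
  qed
  ultimately have "h P \<le> ?M \<and> c < midpoint_info ?M (h P)"
    using range(1)[OF PR] by (intro robust) linarith+
  then have "c \<le> elim_fun ?M (h P)"
    by (simp add: elim_fun_conv_midpoint_info)
  then have "b \<le> real r * elim_fun ?M (h P)"
    using b mult_left_mono[of c _ "real r"] by fastforce
  then have "P \<notin> R'"
    using R' by (auto simp: in_row_iff)
  then show ?thesis
    using PR sub by auto
qed

end

text \<open>The condition \<open>b \<le> r c\<close> holds for the threshold \<open>b = \<beta>(r, \<delta>)\<close> from round \<open>ln (1 / \<delta>) / c'\<close> on,
  for every \<open>c' < c\<close> and small \<open>\<delta>\<close>; hence a progress rate is an asymptotic lower bound on
  \<open>ln (1 / \<delta>)\<close> divided by the number of draws.\<close>

definition progress_rate :: "arm \<Rightarrow> real \<Rightarrow> bool" where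
  "progress_rate P q \<longleftrightarrow> (\<forall>c<q. \<exists>\<eta>0>0. \<forall>\<eta> h b r R R'.
     0 < \<eta> \<and> \<eta> \<le> \<eta>0 \<and> accurate (arms K n) \<mu> \<eta> h \<and> separated (arms K n) \<mu> \<eta> \<and> sound_arms R \<and>
     \<not> stopped R \<and> P \<in> R \<and> racing_round elim_fun b r h R R' \<and> b \<le> real r * c \<longrightarrow> R' \<noteq> R)"

lemma progress_rate_high_arm:
  assumes "P \<in> arms K n" "\<mu> (fst P, 1) < \<mu> P"
  shows "progress_rate P (midpoint_info (\<mu> P) (\<mu> (fst P, 1)))"
  unfolding progress_rate_def
proof (intro allI impI)
  fix c assume "c < midpoint_info (\<mu> P) (\<mu> (fst P, 1))"
  moreover have "fst P \<in> {1..K}"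
    using assms by (auto simp: arms_def)
  ultimately obtain \<eta>0 where \<eta>0: "\<eta>0 > 0"
    "\<And>x y. \<lbrakk>x \<in> {0..1}; y \<in> {0..1}; \<mu> P - \<eta>0 \<le> x; y \<le> \<mu> (fst P, 1) + \<eta>0\<rbrakk>
      \<Longrightarrow> y \<le> x \<and> c < midpoint_info x y"
    using midpoint_info_robust[of "\<mu> (fst P, 1)" "\<mu> P" c] mean_range[OF assms(1)]
      mean_range[OF first_arm] assms(2) by (metis atLeastAtMost_iff)
  show "\<exists>\<eta>0>0. \<forall>\<eta> h b r R R'.
     0 < \<eta> \<and> \<eta> \<le> \<eta>0 \<and> accurate (arms K n) \<mu> \<eta> h \<and> separated (arms K n) \<mu> \<eta> \<and> sound_arms R \<and>
     \<not> stopped R \<and> P \<in> R \<and> racing_round elim_fun b r h R R' \<and> b \<le> real r * c \<longrightarrow> R' \<noteq> R"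
  proof (intro exI[of _ \<eta>0] conjI allI impI; (elim conjE)?)
    fix \<eta> h b r R R'
    assume H: "0 < \<eta>" "\<eta> \<le> \<eta>0" "accurate (arms K n) \<mu> \<eta> h" "separated (arms K n) \<mu> \<eta>"
      "sound_arms R" "\<not> stopped R" "P \<in> R" "racing_round elim_fun b r h R R'" "b \<le> real r * c"
    show "R' \<noteq> R"
      by (rule high_arm_progress[OF H(3,4,5,8,7) assms(2) _ H(9)], rule \<eta>0(2)) (use H(2) in linarith)+
  qed (fact \<eta>0)
qed

text \<open>The bound \<open>m\<close> is uniform while the action \<open>i\<close> may vary with
  the active set. This serves arm \<open>(1, 1)\<close>, for which the remaining competitor is not
  known in advance.\<close>

lemma progress_rate_action:
  assumes "m \<in> {0..1}" "m < \<mu> (1, 1)"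
    and "\<And>R. \<lbrakk>sound_arms R; \<not> stopped R; P \<in> R\<rbrakk> \<Longrightarrow> \<exists>i\<in>fst ` R. i \<noteq> 1 \<and> \<mu> (i, 1) \<le> m"
  shows "progress_rate P (midpoint_info (\<mu> (1, 1)) m)"
  unfolding progress_rate_def
proof (intro allI impI)
  fix c assume "c < midpoint_info (\<mu> (1, 1)) m"
  moreover have "\<mu> (1, 1) \<in> {0..1}"
    using two_actions by (intro mean_range first_arm) auto
  ultimately obtain \<eta>0 where \<eta>0: "\<eta>0 > 0"
    "\<And>x y. \<lbrakk>x \<in> {0..1}; y \<in> {0..1}; \<mu> (1, 1) - \<eta>0 \<le> x; y \<le> m + \<eta>0\<rbrakk>
      \<Longrightarrow> y \<le> x \<and> c < midpoint_info x y"
    using midpoint_info_robust[of m "\<mu> (1, 1)" c] assms(1,2) by (metis atLeastAtMost_iff)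
  show "\<exists>\<eta>0>0. \<forall>\<eta> h b r R R'.
     0 < \<eta> \<and> \<eta> \<le> \<eta>0 \<and> accurate (arms K n) \<mu> \<eta> h \<and> separated (arms K n) \<mu> \<eta> \<and> sound_arms R \<and>
     \<not> stopped R \<and> P \<in> R \<and> racing_round elim_fun b r h R R' \<and> b \<le> real r * c \<longrightarrow> R' \<noteq> R"
  proof (intro exI[of _ \<eta>0] conjI allI impI; (elim conjE)?)
    fix \<eta> h b r R R'
    assume H: "0 < \<eta>" "\<eta> \<le> \<eta>0" "accurate (arms K n) \<mu> \<eta> h" "separated (arms K n) \<mu> \<eta>"
      "sound_arms R" "\<not> stopped R" "P \<in> R" "racing_round elim_fun b r h R R'" "b \<le> real r * c"
    obtain i where i: "i \<in> fst ` R" "i \<noteq> 1" "\<mu> (i, 1) \<le> m"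
      using assms(3) H by blast
    show "R' \<noteq> R"
      by (rule action_progress[OF H(3,4,5,8) i _ H(9)], rule \<eta>0(2)) (use H(2) in linarith)+
  qed (fact \<eta>0)
qed

text \<open>At most \<open>N\<close> draws occur in the first \<open>N\<close> rounds. Each later
  round that draws \<open>P\<close> removes an arm for good, so there are at most as many of them as
  arms. Accuracy is assumed only after round \<open>T\<close>, since up to then nothing is
  eliminated.\<close>

lemma racing_run_draws_le:
  assumes run: "racing_run K n elim_fun \<beta> \<epsilon> \<delta> h R"
    and range: "\<And>r P. h r P \<in> {0..1}"
    and early: "\<And>r. 1 \<le> r \<Longrightarrow> r \<le> T \<Longrightarrow> real r * 2 < \<beta> r \<delta>"
    and acc: "\<And>r. r > T \<Longrightarrow> accurate (arms K n) \<mu> \<eta> (h r)" and sep: "separated (arms K n) \<mu> \<eta>"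
    and late: "\<And>r S S'. \<lbrakk>N < r; sound_arms S; \<not> stopped S; P \<in> S;
       accurate (arms K n) \<mu> \<eta> (h r); racing_round elim_fun (\<beta> r \<delta>) r (h r) S S'\<rbrakk> \<Longrightarrow> S' \<noteq> S"
    and "T \<le> N"
  shows "card {r. r < max_rounds K n \<epsilon> \<delta> \<and> \<not> stopped (R r) \<and> P \<in> R r} \<le> N + num_arms K n"
proof -
  have R0: "R 0 = arms K n"
    using run by (simp add: racing_run_def)
  have round: "racing_round elim_fun (\<beta> (Suc r) \<delta>) (Suc r) (h (Suc r)) (R r) (R (Suc r))"
    if "r < max_rounds K n \<epsilon> \<delta>" "\<not> stopped (R r)" for r
    using run that by (simp add: racing_run_def)
  have frozen: "R (Suc r) = R r" if "\<not> (r < max_rounds K n \<epsilon> \<delta> \<and> \<not> stopped (R r))" for r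
    using run that unfolding racing_run_def by metis
  have sub: "R (Suc r) \<subseteq> R r" for r
    using round[of r] frozen[of r] racing_round_subset by (metis order_refl)
  have const: "R r = arms K n" if "r \<le> T" for r
    using that
  proof (induction r)
    case (Suc r)
    then have IH: "R r = arms K n"
      by simp
    show ?case
    proof (cases "r < max_rounds K n \<epsilon> \<delta> \<and> \<not> stopped (R r)")
      case True
      then have "racing_round elim_fun (\<beta> (Suc r) \<delta>) (Suc r) (h (Suc r)) (arms K n) (R (Suc r))"
        using round IH by metis
      then show ?thesis
        by (rule racing_round_no_elimination)
          (use range two_actions early[of "Suc r"] Suc.prems in \<open>auto simp: fst_arms\<close>)
    qed (use frozen IH in auto)
  qed (simp add: R0)
  \<comment> \<open>Up to \<open>T\<close> the active set is still full, which replaces the missing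
    accuracy; afterwards each round preserves soundness.\<close>
  have sound: "sound_arms (R r)" for r
  proof (induction r)
    case (Suc r)
    show ?case
    proof (cases "Suc r \<le> T")
      case True
      then show ?thesis
        using const sound_arms_arms by simp
    next
      case False
      then show ?thesis
        using Suc frozen[of r] round[of r] sound_racing_round[OF acc sep, of "Suc r"]
        by (metis not_le)
    qed
  qed (simp add: R0 sound_arms_arms)
  \<comment> \<open>The index \<open>r\<close> counts completed rounds, so \<open>N \<le> r\<close>
    refers to round \<open>Suc r > N\<close>, as \<open>late\<close> demands.\<close>
  define D where "D = {r. N \<le> r \<and> r < max_rounds K n \<epsilon> \<delta> \<and> \<not> stopped (R r) \<and> P \<in> R r}"
  have "R r - R (Suc r) \<noteq> {}" if "r \<in> D" for r
  proof -
    have "R (Suc r) \<noteq> R r"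
      using that \<open>T \<le> N\<close> sound acc round by (intro late[of "Suc r"]) (auto simp: D_def)
    then show ?thesis
      using sub by blast
  qed
  then have "\<forall>r\<in>D. \<exists>P. P \<in> R r - R (Suc r)"
    by blast
  \<comment> \<open>\<open>e r\<close> is an arm lost in round \<open>Suc r\<close>. Active sets
    only shrink, so different rounds lose different arms and \<open>e\<close> is injective.\<close>
  from bchoice[OF this] obtain e where e: "\<And>r. r \<in> D \<Longrightarrow> e r \<in> R r - R (Suc r)"
    by blast
  have decr: "R s \<subseteq> R r" if "r \<le> s" for r s
    using lift_Suc_antimono_le[of R] sub that by blast
  have "inj_on e D"
  proof (rule inj_onI)
    have neq: "e r \<noteq> e s" if "r \<in> D" "s \<in> D" "r < s" for r s
      using e[OF that(1)] e[OF that(2)] decr[of "Suc r" s] that(3) by auto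
    fix r s assume "r \<in> D" "s \<in> D" "e r = e s"
    then show "r = s"
      using neq by (metis linorder_neqE_nat)
  qed
  moreover have "e ` D \<subseteq> arms K n"
    using e decr[of 0] R0 by blast
  ultimately have "card D \<le> num_arms K n"
    using card_inj_on_le[of e D "arms K n"] by (simp add: card_arms)
  moreover have "card {r. r < max_rounds K n \<epsilon> \<delta> \<and> \<not> stopped (R r) \<and> P \<in> R r} \<le> card ({..<N} \<union> D)"
    by (intro card_mono) (auto simp: D_def)
  moreover have "card ({..<N} \<union> D) \<le> N + card D"
    using card_Un_le[of "{..<N}" D] by simp
  ultimately show ?thesis
    by linarith
qed

end

section \<open>Concentration and expected number of draws\<close>

lemma emp_mean_range: "emp_mean X r \<omega> P \<in> {0..1}"
proof -
  have "(\<Sum>t=1..r. of_bool (X P t \<omega>)) \<le> (\<Sum>t=1..r. 1 :: real)"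
    by (intro sum_mono) auto
  then show ?thesis
    by (auto simp: emp_mean_def sum_nonneg divide_le_eq_1)
qed

section \<open>Concentration of the empirical means\<close>

context
  fixes M :: "'w measure" and A :: "arm set" and \<mu> :: "arm \<Rightarrow> real"
    and X :: "arm \<Rightarrow> nat \<Rightarrow> 'w \<Rightarrow> bool"
  assumes prob: "prob_space M" and rewards: "bernoulli_rewards M A \<mu> X"
begin

interpretation prob_space M
  by (rule prob)

lemma measurable_reward:
  assumes "P \<in> A" "t \<ge> 1"
  shows "X P t \<in> measurable M (count_space UNIV)"
  using rewards assms unfolding bernoulli_rewards_def indep_vars_def by fastforce

lemma measurable_emp_mean:
  assumes "P \<in> A"
  shows "(\<lambda>\<omega>. emp_mean X r \<omega> P) \<in> borel_measurable M"
proof -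
  have "(\<lambda>\<omega>. of_bool (X P t \<omega>) :: real) \<in> borel_measurable M" if "t \<in> {1..r}" for t
    using measurable_compose[OF measurable_reward[OF assms, of t], of of_bool borel] that by simp
  then show ?thesis
    unfolding emp_mean_def by (intro borel_measurable_divide borel_measurable_sum) auto
qed

lemma emp_mean_deviation:
  assumes P: "P \<in> A" and r: "r \<ge> 1" and \<eta>: "\<eta> \<ge> 0"
  shows "measure M {\<omega> \<in> space M. \<bar>emp_mean X r \<omega> P - \<mu> P\<bar> \<ge> \<eta>} \<le> 2 * exp (- 2 * real r * \<eta>\<^sup>2)"
proof -
  let ?I = "{P} \<times> {1..r}"
  let ?Z = "\<lambda>(P, t) \<omega>. of_bool (X P t \<omega>) :: real"
  have distr: "distr M borel (?Z (P, t)) = distr (measure_pmf (bernoulli_pmf (\<mu> P))) borel of_bool"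
    if "t \<ge> 1" for t
  proof -
    have "distr M borel (?Z (P, t)) = distr (distr M (count_space UNIV) (X P t)) borel of_bool"
      using measurable_reward[OF P that] by (subst distr_distr) (auto simp: o_def)
    then show ?thesis
      using rewards P that by (simp add: bernoulli_rewards_def)
  qed
  have indep: "indep_vars (\<lambda>_. borel) ?Z ?I"
  proof -
    have "indep_vars (\<lambda>_. count_space UNIV) (\<lambda>(P, t). X P t) ?I"
    proof (rule indep_vars_subset)
      show "indep_vars (\<lambda>_. count_space UNIV) (\<lambda>(P, t). X P t) (A \<times> {1..})"
        using rewards by (simp add: bernoulli_rewards_def)
    qed (use P in auto)
    from indep_vars_compose2[OF this, of "\<lambda>_. of_bool" "\<lambda>_. borel"] show ?thesis
      by (simp add: case_prod_beta')
  qed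
  have meas: "?Z (P, 1) \<in> borel_measurable M"
    using measurable_compose[OF measurable_reward[OF P, of 1], of of_bool borel] by simp
  have "\<mu> P \<in> {0..1}"
    using rewards P by (simp add: bernoulli_rewards_def)
  then have "measure_pmf.expectation (bernoulli_pmf (\<mu> P)) (\<lambda>x. of_bool x) = \<mu> P"
    by simp
  moreover have "expectation (?Z (P, 1)) = integral\<^sup>L (distr M borel (?Z (P, 1))) (\<lambda>x. x)"
    using meas by (subst integral_distr) auto
  ultimately have exp: "expectation (?Z (P, 1)) = \<mu> P"
    unfolding distr[OF order_refl] by (subst (asm) integral_distr) auto
  \<comment> \<open>The sample consists of the first \<open>r\<close> entries of the row of
    \<open>P\<close> in the table of potential outcomes, so no dependence on the algorithm enters.
    Draw 1 serves as the reference variable.\<close>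
  interpret Hoeffding_ineq_iid M ?I ?Z "?Z (P, 1)" 0 1 "\<mu> P"
    by unfold_locales (use indep distr meas exp in auto)
  have "(\<Sum>i\<in>?I. ?Z i \<omega>) / real (card ?I) = emp_mean X r \<omega> P" for \<omega>
  proof -
    have "(\<Sum>i\<in>?I. ?Z i \<omega>) = (\<Sum>t=1..r. of_bool (X P t \<omega>))"
      by (rule sum.reindex_bij_witness[where i = "\<lambda>t. (P, t)" and j = snd]) auto
    then show ?thesis
      by (simp add: emp_mean_def)
  qed
  then show ?thesis
    using Hoeffding_ineq_abs_ge'[OF \<eta>] r by simp
qed

text \<open>A union bound over the arms makes the probability of inaccuracy at round
  \<open>r\<close> geometrically small. These probabilities are summable, and the bad event after
  \<open>T\<close> is bounded by a tail of the series.\<close>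

lemma inaccurate_tail:
  assumes "finite A" "\<eta> > 0"
  defines "B \<equiv> \<lambda>T. {\<omega> \<in> space M. \<exists>r>T. \<not> accurate A \<mu> \<eta> (emp_mean X r \<omega>)}"
  shows "B T \<in> sets M" and "(\<lambda>T. measure M (B T)) \<longlonglongrightarrow> 0"
proof -
  define D where "D = (\<lambda>r. \<Union>P\<in>A. {\<omega> \<in> space M. \<bar>emp_mean X r \<omega> P - \<mu> P\<bar> \<ge> \<eta>})"
  have D_P: "{\<omega> \<in> space M. \<bar>emp_mean X r \<omega> P - \<mu> P\<bar> \<ge> \<eta>} \<in> sets M" if "P \<in> A" for P r
    using measurable_emp_mean[OF that, of r] by measurable
  then have D: "D r \<in> sets M" for r
    unfolding D_def using assms(1) by (intro sets.finite_UN) auto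
  have B: "B T = (\<Union>k. D (k + Suc T))" for T
  proof -
    have "(\<exists>r>T. Q r) \<longleftrightarrow> (\<exists>k. Q (k + Suc T))" for Q
      by (metis add.commute less_iff_Suc_add add_Suc_right less_add_Suc2)
    \<comment> \<open>Empirical means always lie in the unit interval, so inaccuracy means a
      deviation of at least \<open>\<eta>\<close>.\<close>
    then show ?thesis
      using emp_mean_range[of X] by (auto simp: B_def D_def accurate_def not_less)
  qed
  show "B T \<in> sets M"
    unfolding B using D by (intro sets.countable_UN) auto
  have bound: "measure M (D r) \<le> real (card A) * 2 * exp (- 2 * \<eta>\<^sup>2) ^ r" if "r \<ge> 1" for r
  proof -
    have "measure M (D r) \<le> (\<Sum>P\<in>A. measure M {\<omega> \<in> space M. \<bar>emp_mean X r \<omega> P - \<mu> P\<bar> \<ge> \<eta>})"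
      unfolding D_def using assms(1) D_P by (intro finite_measure_subadditive_finite) auto
    also have "\<dots> \<le> (\<Sum>P\<in>A. 2 * exp (- 2 * real r * \<eta>\<^sup>2))"
      using that assms(2) by (intro sum_mono emp_mean_deviation) auto
    also have "\<dots> = real (card A) * 2 * exp (- 2 * \<eta>\<^sup>2) ^ r"
      by (simp add: exp_of_nat_mult[symmetric] mult_ac)
    finally show ?thesis .
  qed
  have "summable (\<lambda>r. measure M (D r))"
  proof (rule summable_comparison_test')
    show "summable (\<lambda>r. real (card A) * 2 * exp (- 2 * \<eta>\<^sup>2) ^ r)"
      using assms(2) by (intro summable_mult summable_geometric) auto
  qed (use bound in auto)
  then have lim: "(\<lambda>T. \<Sum>k. measure M (D (k + Suc T))) \<longlonglongrightarrow> 0"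
    and summ: "summable (\<lambda>k. measure M (D (k + T)))" for T
    using LIMSEQ_Suc[OF suminf_exist_split2] summable_iff_shift[of "\<lambda>r. measure M (D r)" T] by auto
  show "(\<lambda>T. measure M (B T)) \<longlonglongrightarrow> 0"
  proof (rule tendsto_sandwich[OF _ _ tendsto_const lim])
    show "\<forall>\<^sub>F T in sequentially. measure M (B T) \<le> (\<Sum>k. measure M (D (k + Suc T)))"
      unfolding B using D summ by (intro always_eventually allI finite_measure_subadditive_countably)
        (auto simp del: add_Suc_right)
  qed simp
qed

end

text \<open>Substituting \<open>ln (1 / \<delta>)\<close>, which tends to infinity as
  \<open>\<delta>\<close> decreases to 0, turns the bound into a limit of a real function at
  infinity.\<close>

lemma Limsup_at_right_0_le_log:
  fixes f G :: "real \<Rightarrow> real"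
  assumes "(G \<longlongrightarrow> l) at_top" "\<forall>\<^sub>F \<delta> in at_right 0. f \<delta> \<le> G (ln (1 / \<delta>))"
  shows "Limsup (at_right 0) (\<lambda>\<delta>. ereal (f \<delta>)) \<le> ereal l"
proof -
  have "filterlim (\<lambda>\<delta>::real. ln (1 / \<delta>)) at_top (at_right 0)"
    by real_asymp
  then have "((\<lambda>\<delta>. ereal (G (ln (1 / \<delta>)))) \<longlongrightarrow> ereal l) (at_right 0)"
    using filterlim_compose[OF assms(1)] by (intro tendsto_intros) blast
  then have "Limsup (at_right 0) (\<lambda>\<delta>. ereal (G (ln (1 / \<delta>)))) = ereal l"
    by (intro lim_imp_Limsup) auto
  moreover have "Limsup (at_right 0) (\<lambda>\<delta>. ereal (f \<delta>))
      \<le> Limsup (at_right 0) (\<lambda>\<delta>. ereal (G (ln (1 / \<delta>))))"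
    using assms(2) by (intro Limsup_mono) simp
  ultimately show ?thesis
    by simp
qed

lemma max_rounds_le:
  assumes "num_arms K n \<ge> 1" "0 < \<delta>" "\<delta> < 1"
  shows "real (max_rounds K n \<epsilon> \<delta>) \<le> 2 / \<epsilon>\<^sup>2 * (ln (4 * real (num_arms K n)) + ln (1 / \<delta>)) + 1"
proof -
  have "ln (4 * real (num_arms K n) / \<delta>) = ln (4 * real (num_arms K n)) + ln (1 / \<delta>)"
    using assms by (simp add: ln_div)
  moreover have "0 \<le> ln (4 * real (num_arms K n)) + ln (1 / \<delta>)"
    using assms by (intro add_nonneg_nonneg ln_ge_zero) auto
  moreover from this have "0 \<le> 2 / \<epsilon>\<^sup>2 * (ln (4 * real (num_arms K n)) + ln (1 / \<delta>))"
    by (intro mult_nonneg_nonneg) auto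
  ultimately show ?thesis
    unfolding max_rounds_def by (simp only:) linarith
qed

lemma num_draws_le_max_rounds: "num_draws K n \<epsilon> \<delta> R P \<omega> \<le> max_rounds K n \<epsilon> \<delta>"
proof -
  have "num_draws K n \<epsilon> \<delta> R P \<omega> \<le> card {..<max_rounds K n \<epsilon> \<delta>}"
    unfolding num_draws_def by (intro card_mono) auto
  then show ?thesis
    by simp
qed

lemma log_threshold_eq:
  assumes "C > 0" "\<delta> > 0" "r \<ge> 1"
  shows "log_threshold C r \<delta> = ln (4 * C) + ln (real r) + ln (1 / \<delta>)"
  using assms by (simp add: log_threshold_def ln_div ln_mult)

section \<open>Bounds on the expected number of draws\<close>

context maximin_means
begin

lemma num_arms_pos: "num_arms K n \<ge> 1"
proof -
  have "card {(1, 1) :: arm} \<le> card (arms K n)"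
    by (rule card_mono) (use first_arm[of 1] two_actions in auto)
  then show ?thesis
    by (simp add: card_arms)
qed

text \<open>The horizon bounds the draws of every arm pointwise and grows like
  \<open>2 / \<epsilon>\<^sup>2\<close> times \<open>ln (1 / \<delta>)\<close>; this accounts for
  the term \<open>\<epsilon>\<^sup>2 / 2\<close> in the maxima.\<close>

lemma Limsup_draws_le_max_rounds:
  assumes "prob_space M" "\<epsilon> > 0"
  shows "Limsup (at_right 0)
    (\<lambda>\<delta>. ereal ((\<integral>\<omega>. real (num_draws K n \<epsilon> \<delta> (R \<delta>) P \<omega>) \<partial>M) / ln (1 / \<delta>))) \<le> ereal (1 / (\<epsilon>\<^sup>2 / 2))"
proof (rule Limsup_at_right_0_le_log)
  interpret prob_space M
    by fact
  define v w where "v = 2 / \<epsilon>\<^sup>2" and "w = ln (4 * real (num_arms K n))"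
  have "((\<lambda>x. (v * (w + x) + 1) / x) \<longlongrightarrow> v) at_top"
    using assms(2) by (real_asymp simp: v_def)
  then show "((\<lambda>x. (v * (w + x) + 1) / x) \<longlongrightarrow> 1 / (\<epsilon>\<^sup>2 / 2)) at_top"
    by (simp add: v_def)
  have "\<forall>\<^sub>F \<delta> in at_right 0. \<delta> < (1::real)"
    by (rule eventually_at_rightI[of 0 1]) auto
  moreover have "\<forall>\<^sub>F \<delta> in at_right 0. 0 < (\<delta>::real)"
    by (rule eventually_at_right_less)
  ultimately show "\<forall>\<^sub>F \<delta> in at_right 0. (\<integral>\<omega>. real (num_draws K n \<epsilon> \<delta> (R \<delta>) P \<omega>) \<partial>M) / ln (1 / \<delta>)
      \<le> (v * (w + ln (1 / \<delta>)) + 1) / ln (1 / \<delta>)"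
  proof eventually_elim
    case (elim \<delta>)
    have "(\<integral>\<omega>. real (num_draws K n \<epsilon> \<delta> (R \<delta>) P \<omega>) \<partial>M) \<le> (\<integral>\<omega>. real (max_rounds K n \<epsilon> \<delta>) \<partial>M)"
      by (rule integral_mono') (auto simp: num_draws_le_max_rounds)
    also have "\<dots> = real (max_rounds K n \<epsilon> \<delta>)"
      by (simp add: prob_space)
    also have "\<dots> \<le> v * (w + ln (1 / \<delta>)) + 1"
      unfolding v_def w_def using max_rounds_le num_arms_pos elim by blast
    finally show ?case
      using elim by (intro divide_right_mono) auto
  qed
qed

text \<open>The expectation is split at the event of a late inaccuracy: the horizon bounds the draws
  on it, the deterministic count bounds them off it.\<close>

lemma expected_draws_le:
  assumes "prob_space M" "bernoulli_rewards M (arms K n) \<mu> X" and "C > 0" "0 < \<delta>" "\<delta> < 1"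
    and run: "maximin_racing M K n elim_fun (log_threshold C) \<epsilon> \<delta> X R ihat"
    and early: "real T * 2 < ln (4 * C) + ln (1 / \<delta>)"
    and sep: "separated (arms K n) \<mu> \<eta>" "\<eta> > 0"
    and progress: "\<And>h b r S S'. \<lbrakk>accurate (arms K n) \<mu> \<eta> h; sound_arms S; \<not> stopped S; P \<in> S;
       racing_round elim_fun b r h S S'; b \<le> real r * c\<rbrakk> \<Longrightarrow> S' \<noteq> S"
    and late: "\<And>r. r > N \<Longrightarrow> ln (4 * C) + ln (real r) + ln (1 / \<delta>) \<le> real r * c"
    and "T \<le> N"
  shows "(\<integral>\<omega>. real (num_draws K n \<epsilon> \<delta> R P \<omega>) \<partial>M) \<le> real N + real (num_arms K n) +
    real (max_rounds K n \<epsilon> \<delta>) *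
      measure M {\<omega> \<in> space M. \<exists>r>T. \<not> accurate (arms K n) \<mu> \<eta> (emp_mean X r \<omega>)}"
proof -
  interpret prob_space M
    by fact
  define B where "B = {\<omega> \<in> space M. \<exists>r>T. \<not> accurate (arms K n) \<mu> \<eta> (emp_mean X r \<omega>)}"
  have B: "B \<in> sets M"
    unfolding B_def using assms by (intro inaccurate_tail) auto
  have good: "num_draws K n \<epsilon> \<delta> R P \<omega> \<le> N + num_arms K n" if \<omega>: "\<omega> \<in> space M" "\<omega> \<notin> B" for \<omega>
    unfolding num_draws_def
  proof (rule racing_run_draws_le)
    show "racing_run K n elim_fun (log_threshold C) \<epsilon> \<delta> (\<lambda>r. emp_mean X r \<omega>) (\<lambda>r. R r \<omega>)"
      using run \<omega> by (simp add: maximin_racing_def)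
    show "real r * 2 < log_threshold C r \<delta>" if "1 \<le> r" "r \<le> T" for r
    proof -
      have "real r * 2 \<le> real T * 2" "ln (real r) \<ge> 0"
        using that by auto
      then show ?thesis
        using early that assms(3,4) by (simp only: log_threshold_eq)
    qed
    show "accurate (arms K n) \<mu> \<eta> (emp_mean X r \<omega>)" if "T < r" for r
      using \<omega> that by (auto simp: B_def)
    show "S' \<noteq> S" if "N < r" "sound_arms S" "\<not> stopped S" "P \<in> S"
      "accurate (arms K n) \<mu> \<eta> (emp_mean X r \<omega>)"
      "racing_round elim_fun (log_threshold C r \<delta>) r (emp_mean X r \<omega>) S S'" for r S S'
      using that late[of r] assms by (intro progress[OF that(5,2,3,4,6)]) (simp add: log_threshold_eq)
    show "emp_mean X r \<omega> Q \<in> {0..1}" for r Q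
      by (rule emp_mean_range)
  qed (use sep assms in auto)
  have int: "integrable M (indicat_real B)"
    using B by (rule integrable_real_indicator) (simp add: less_top[symmetric])
  have "(\<integral>\<omega>. real (num_draws K n \<epsilon> \<delta> R P \<omega>) \<partial>M)
    \<le> (\<integral>\<omega>. (real N + real (num_arms K n)) + real (max_rounds K n \<epsilon> \<delta>) * indicator B \<omega> \<partial>M)"
  proof (rule integral_mono')
    show "real (num_draws K n \<epsilon> \<delta> R P \<omega>) \<le>
      (real N + real (num_arms K n)) + real (max_rounds K n \<epsilon> \<delta>) * indicator B \<omega>"
      if "\<omega> \<in> space M" for \<omega>
      using good[OF that] num_draws_le_max_rounds[of K n \<epsilon> \<delta> R P \<omega>] by (cases "\<omega> \<in> B") auto
    show "integrable M (\<lambda>\<omega>. (real N + real (num_arms K n)) + real (max_rounds K n \<epsilon> \<delta>) * indicator B \<omega>)"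
      using int by simp
  qed auto
  also have "\<dots> = (real N + real (num_arms K n)) + real (max_rounds K n \<epsilon> \<delta>) * measure M B"
    using int B by (subst Bochner_Integration.integral_add) (auto simp: prob_space)
  finally show ?thesis
    by (simp add: B_def)
qed

text \<open>For each \<open>c < q\<close> the count is run with \<open>T\<close> about
  \<open>ln (1 / \<delta>) / 4\<close> and \<open>N\<close> about
  \<open>ln (1 / \<delta>) / c\<close>; then \<open>c\<close> tends to \<open>q\<close> from
  below.\<close>

lemma Limsup_draws_le_rate:
  assumes "prob_space M" "bernoulli_rewards M (arms K n) \<mu> X" "\<epsilon> > 0" "C > 0"
    and run: "\<forall>\<delta>\<in>{0<..<1}.
      maximin_racing M K n elim_fun (log_threshold C) \<epsilon> \<delta> X (R \<delta>) (ihat \<delta>)"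
    and rate: "progress_rate P q" and q: "0 < q" "q \<le> 4"
  shows "Limsup (at_right 0)
    (\<lambda>\<delta>. ereal ((\<integral>\<omega>. real (num_draws K n \<epsilon> \<delta> (R \<delta>) P \<omega>) \<partial>M) / ln (1 / \<delta>))) \<le> ereal (1 / q)"
    (is "?L \<le> _")
proof -
  have bound: "?L \<le> ereal (1 / c)" if c: "0 < c" "c < q" for c
  proof -
    \<comment> \<open>Two rates are needed: the test uses \<open>c'\<close>, the number of rounds
      uses \<open>c\<close>, and the slack \<open>(c' - c) * r\<close> absorbs the terms
      \<open>ln (4 * C)\<close> and \<open>ln r\<close> of the threshold.\<close>
    define c' where "c' = (c + q) / 2"
    have c': "c < c'" "c' < q"
      using c by (auto simp: c'_def)
    obtain \<eta>0 where \<eta>0: "\<eta>0 > 0" "\<And>\<eta> h b r S S'. \<lbrakk>0 < \<eta>; \<eta> \<le> \<eta>0; accurate (arms K n) \<mu> \<eta> h;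
        separated (arms K n) \<mu> \<eta>; sound_arms S; \<not> stopped S; P \<in> S;
        racing_round elim_fun b r h S S'; b \<le> real r * c'\<rbrakk> \<Longrightarrow> S' \<noteq> S"
      using rate c'(2) unfolding progress_rate_def by metis
    obtain \<eta>1 where \<eta>1: "\<eta>1 > 0" "separated (arms K n) \<mu> \<eta>1"
      using separated_exists[OF finite_arms] .
    define \<eta> where "\<eta> = min \<eta>0 \<eta>1"
    have \<eta>: "\<eta> > 0" "\<eta> \<le> \<eta>0" "separated (arms K n) \<mu> \<eta>"
      using \<eta>0(1) \<eta>1 separated_mono[OF \<eta>1(2)] by (auto simp: \<eta>_def)
    define p where
      "p = (\<lambda>T. measure M {\<omega> \<in> space M. \<exists>r>T. \<not> accurate (arms K n) \<mu> \<eta> (emp_mean X r \<omega>)})"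
    define v w k where "v = 2 / \<epsilon>\<^sup>2" and "w = ln (4 * real (num_arms K n))" and "k = real (num_arms K n)"
    have "p \<longlonglongrightarrow> 0"
      unfolding p_def using assms(1,2) \<eta>(1) by (intro inaccurate_tail) auto
    moreover have "filterlim (\<lambda>x::real. nat \<lfloor>x / 4\<rfloor>) at_top at_top"
      by (intro filterlim_compose[OF filterlim_nat_sequentially]
          filterlim_compose[OF filterlim_floor_sequentially]) real_asymp
    ultimately have p: "((\<lambda>x::real. p (nat \<lfloor>x / 4\<rfloor>)) \<longlongrightarrow> 0) at_top"
      by (rule filterlim_compose)
    have "v > 0"
      using assms(3) by (simp add: v_def)
    then have "((\<lambda>x. (v * (w + x) + 1) / x) \<longlongrightarrow> v) at_top"
      by real_asymp
    moreover have "((\<lambda>x. (x / c + 1 + k) / x) \<longlongrightarrow> 1 / c) at_top"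
      using c by (real_asymp simp: inverse_eq_divide)
    \<comment> \<open>The horizon divided by \<open>x\<close> stays bounded while the probability of
      inaccuracy vanishes, so the bad event contributes nothing in the limit.\<close>
    ultimately have "((\<lambda>x. (x / c + 1 + k) / x + (v * (w + x) + 1) / x * p (nat \<lfloor>x / 4\<rfloor>))
        \<longlongrightarrow> 1 / c + v * 0) at_top"
      by (intro tendsto_add tendsto_mult p)
    then have lim: "((\<lambda>x. (x / c + 1 + k) / x + (v * (w + x) + 1) / x * p (nat \<lfloor>x / 4\<rfloor>))
        \<longlongrightarrow> 1 / c) at_top"
      by simp
    have "c' - c > 0"
      using c' by simp
    then have "\<forall>\<^sub>F r in sequentially. ln (4 * C) + ln (real r) \<le> (c' - c) * real r"
      by real_asymp
    then obtain r0 where r0: "\<And>r. r \<ge> r0 \<Longrightarrow> ln (4 * C) + ln (real r) \<le> (c' - c) * real r"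
      by (auto simp: eventually_sequentially)
    have "filterlim (\<lambda>\<delta>::real. ln (1 / \<delta>)) at_top (at_right 0)"
      by real_asymp
    \<comment> \<open>The first bound yields \<open>early\<close>, as
      \<open>2 * T \<le> x / 2\<close> leaves \<open>x / 2\<close> to offset a negative
      \<open>ln (4 * C)\<close>. The second puts \<open>N\<close> beyond \<open>r0\<close>.\<close>
    then have "\<forall>\<^sub>F \<delta> in at_right 0. max (- 2 * ln (4 * C)) (c * real r0) < ln (1 / \<delta>)"
      unfolding filterlim_at_top_dense by blast
    moreover have "\<forall>\<^sub>F \<delta> in at_right 0. \<delta> < (1::real)"
      by (rule eventually_at_rightI[of 0 1]) auto
    moreover have "\<forall>\<^sub>F \<delta> in at_right 0. 0 < (\<delta>::real)"
      by (rule eventually_at_right_less)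
    ultimately have "\<forall>\<^sub>F \<delta> in at_right 0. (\<integral>\<omega>. real (num_draws K n \<epsilon> \<delta> (R \<delta>) P \<omega>) \<partial>M) / ln (1 / \<delta>)
        \<le> (ln (1 / \<delta>) / c + 1 + k) / ln (1 / \<delta>) +
          (v * (w + ln (1 / \<delta>)) + 1) / ln (1 / \<delta>) * p (nat \<lfloor>ln (1 / \<delta>) / 4\<rfloor>)"
    proof eventually_elim
      case (elim \<delta>)
      define x where "x = ln (1 / \<delta>)"
      have x: "x > 0" "- 2 * ln (4 * C) < x" "c * real r0 < x"
        using elim by (auto simp: x_def)
      define T N where "T = nat \<lfloor>x / 4\<rfloor>" and "N = nat \<lceil>x / c\<rceil>"
      have T: "real T \<le> x / 4"
        unfolding T_def using x by linarith
      have N: "x / c \<le> real N" "real N \<le> x / c + 1"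
        using x c by (auto simp: N_def)
      have "x / 4 \<le> x / c"
        \<comment> \<open>Here \<open>c < q \<le> 4\<close> enters: eliminations start before the
          count of removals does.\<close>
        using x c q by (intro divide_left_mono) auto
      then have "T \<le> N"
        using T N by linarith
      have late: "ln (4 * C) + ln (real r) + x \<le> real r * c'" if "r > N" for r
      proof -
        have "x / c \<le> real r" "real r0 < x / c"
          using that N x c by (linarith, simp add: field_simps)
        then have "x \<le> c * real r" "real r0 \<le> real r"
          using c by (simp add: field_simps, linarith)
        then show ?thesis
          using r0[of r] by (simp add: algebra_simps)
      qed
      have "(\<integral>\<omega>. real (num_draws K n \<epsilon> \<delta> (R \<delta>) P \<omega>) \<partial>M)
          \<le> real N + real (num_arms K n) + real (max_rounds K n \<epsilon> \<delta>) * p T"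
        unfolding p_def
      proof (rule expected_draws_le[where c = c' and C = C and ihat = "ihat \<delta>"])
        show "real T * 2 < ln (4 * C) + ln (1 / \<delta>)"
          using T x by (simp add: x_def)
        show "ln (4 * C) + ln (real r) + ln (1 / \<delta>) \<le> real r * c'" if "r > N" for r
          using late[OF that] by (simp add: x_def)
        show "S' \<noteq> S" if "accurate (arms K n) \<mu> \<eta> h" "sound_arms S" "\<not> stopped S" "P \<in> S"
          "racing_round elim_fun b r h S S'" "b \<le> real r * c'" for h b r S S'
          using \<eta>0(2)[OF \<eta>(1,2) that(1) \<eta>(3) that(2-)] .
      qed (use assms elim \<eta> \<open>T \<le> N\<close> in auto)
      also have "\<dots> \<le> (x / c + 1 + k) + (v * (w + x) + 1) * p T"
      proof (intro add_mono mult_right_mono)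
        show "real (max_rounds K n \<epsilon> \<delta>) \<le> v * (w + x) + 1"
          unfolding v_def w_def x_def using max_rounds_le num_arms_pos elim by blast
      qed (use N in \<open>auto simp: k_def p_def\<close>)
      finally have "(\<integral>\<omega>. real (num_draws K n \<epsilon> \<delta> (R \<delta>) P \<omega>) \<partial>M) / x
          \<le> ((x / c + 1 + k) + (v * (w + x) + 1) * p T) / x"
        using x(1) by (intro divide_right_mono) auto
      moreover have "(a + b * d) / x = a / x + b / x * d" for a b d
        by (simp add: add_divide_distrib)
      ultimately show ?case
        by (simp only: T_def flip: x_def)
    qed
    with lim show ?thesis
      by (rule Limsup_at_right_0_le_log)
  qed
  have "((\<lambda>c. ereal (1 / c)) \<longlongrightarrow> ereal (1 / q)) (at_left q)"
    using q by (intro tendsto_intros) auto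
  moreover have "\<forall>\<^sub>F c in at_left q. ?L \<le> ereal (1 / c)"
    using q bound by (intro eventually_at_leftI[of 0]) auto
  ultimately show ?thesis
    by (rule tendsto_lowerbound) simp
qed

end

theorem theorem8:
  fixes M :: "'w measure"
    and K :: nat
    and n :: "nat \<Rightarrow> nat"
    and \<mu> :: "nat \<times> nat \<Rightarrow> real"
    and X :: "nat \<times> nat \<Rightarrow> nat \<Rightarrow> 'w \<Rightarrow> bool"
    and \<epsilon> C :: real
    and R :: "real \<Rightarrow> nat \<Rightarrow> 'w \<Rightarrow> (nat \<times> nat) set"
    and ihat :: "real \<Rightarrow> 'w \<Rightarrow> nat"
  assumes "prob_space M"
    and "K \<ge> 2"
    and "\<forall>i\<in>{1..K}. n i \<ge> 1"
    and "bernoulli_rewards M (arms K n) \<mu> X"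
    and "\<forall>i\<in>{1..K}. mono_on {1..n i} (\<lambda>j. \<mu> (i, j))"
    and "antimono_on {1..K} (\<lambda>i. \<mu> (i, 1))"
    and "\<mu> (1, 1) > \<mu> (2, 1)"
    and "\<epsilon> > 0"
    and "0 < C" and "C \<le> (real (num_arms K n))\<^sup>2"
    and "(\<forall>i\<in>{1..K}. n i \<ge> 2 \<longrightarrow> \<mu> (i, 1) < \<mu> (i, 2)) \<longrightarrow> C = real K * real (Max (n ` {1..K}))"
    and "\<forall>\<delta>\<in>{0<..<1}.
           maximin_racing M K n elim_fun (log_threshold C) \<epsilon> \<delta> X (R \<delta>) (ihat \<delta>)"
    and "\<forall>\<delta>\<in>{0<..<1}.
           measure M {\<omega> \<in> space M. \<mu> (1, 1) - \<mu> (ihat \<delta> \<omega>, 1) \<le> \<epsilon>} \<ge> 1 - \<delta>"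
  shows "Limsup (at_right 0)
           (\<lambda>\<delta>. ereal ((\<integral>\<omega>. real (num_draws K n \<epsilon> \<delta> (R \<delta>) (1, 1) \<omega>) \<partial>M) / ln (1 / \<delta>)))
         \<le> ereal (1 / max (\<epsilon>\<^sup>2 / 2) (midpoint_info (\<mu> (2, 1)) (\<mu> (1, 1)))) \<and>
         (\<forall>i j. (i, j) \<in> arms K n \<and> (i, j) \<noteq> (1, 1) \<longrightarrow>
           Limsup (at_right 0)
             (\<lambda>\<delta>. ereal ((\<integral>\<omega>. real (num_draws K n \<epsilon> \<delta> (R \<delta>) (i, j) \<omega>) \<partial>M) / ln (1 / \<delta>)))
           \<le> ereal (1 / Max {\<epsilon>\<^sup>2 / 2, midpoint_info (\<mu> (i, 1)) (\<mu> (1, 1)),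
                             midpoint_info (\<mu> (i, j)) (\<mu> (i, 1))}))"
proof -
  interpret maximin_means K n \<mu>
    using assms by unfold_locales (auto simp: bernoulli_rewards_def)
  let ?L = "\<lambda>P. Limsup (at_right 0)
    (\<lambda>\<delta>. ereal ((\<integral>\<omega>. real (num_draws K n \<epsilon> \<delta> (R \<delta>) P \<omega>) \<partial>M) / ln (1 / \<delta>)))"
  note rounds = Limsup_draws_le_max_rounds[OF assms(1,8)]
  note rate = Limsup_draws_le_rate[OF assms(1,4,8,9,12)]
  have mean_1: "\<mu> (i, 1) \<in> {0..1}" if "i \<in> {1..K}" for i
    using that by (intro mean_range first_arm)
  have one: "1 \<in> {1..K}" and two: "2 \<in> {1..K}"
    using assms(2) by auto
  have pos: "\<epsilon>\<^sup>2 / 2 > 0"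
    using assms(8) by simp
  have "?L (1, 1) \<le> ereal (1 / max (\<epsilon>\<^sup>2 / 2) (midpoint_info (\<mu> (2, 1)) (\<mu> (1, 1))))"
  proof (cases "midpoint_info (\<mu> (2, 1)) (\<mu> (1, 1)) \<le> \<epsilon>\<^sup>2 / 2")
    case True
    then show ?thesis
      using rounds by (simp only: max_absorb1)
  next
    case False
    then have gt: "midpoint_info (\<mu> (1, 1)) (\<mu> (2, 1)) > \<epsilon>\<^sup>2 / 2"
      by (simp only: midpoint_info_commute not_le)
    \<comment> \<open>As long as the race goes on, some action other than 1 is active, and its
      minimal mean is at most \<open>\<mu> (2, 1)\<close>.\<close>
    have "progress_rate (1, 1) (midpoint_info (\<mu> (1, 1)) (\<mu> (2, 1)))"
      using mean_1[OF two] mean_gap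
    proof (rule progress_rate_action)
      show "\<exists>i\<in>fst ` S. i \<noteq> 1 \<and> \<mu> (i, 1) \<le> \<mu> (2, 1)" if "sound_arms S" "\<not> stopped S" for S
        using sound_not_stopped[OF that] sound_arms_action[OF that(1)] later_action_le by metis
    qed
    moreover have "midpoint_info (\<mu> (1, 1)) (\<mu> (2, 1)) \<le> 2"
      using mean_1[OF one] mean_1[OF two] mean_gap by (intro midpoint_info_le) auto
    ultimately have "?L (1, 1) \<le> ereal (1 / midpoint_info (\<mu> (1, 1)) (\<mu> (2, 1)))"
      using pos gt by (intro rate) linarith+
    then show ?thesis
      using gt by (simp only: midpoint_info_commute[of "\<mu> (2, 1)"] max_absorb2 less_imp_le)
  qed
  moreover have "?L (i, j) \<le> ereal (1 / Max {\<epsilon>\<^sup>2 / 2, midpoint_info (\<mu> (i, 1)) (\<mu> (1, 1)),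
      midpoint_info (\<mu> (i, j)) (\<mu> (i, 1))})" (is "_ \<le> ereal (1 / Max ?S)") if ij: "(i, j) \<in> arms K n" for i j
  proof -
    have i: "i \<in> {1..K}"
      using ij by (auto simp: arms_def)
    note range = mean_range[OF ij] mean_1[OF i] mean_1[OF one]
    have max: "Max ?S > 0"
      using pos by (simp add: less_max_iff_disj)
    \<comment> \<open>Each of the three terms has its own bound, so it is enough to use the one that
      attains the maximum.\<close>
    have "Max ?S \<in> ?S"
      by (rule Max_in) auto
    then consider "Max ?S = \<epsilon>\<^sup>2 / 2" | "Max ?S = midpoint_info (\<mu> (i, 1)) (\<mu> (1, 1))"
      | "Max ?S = midpoint_info (\<mu> (i, j)) (\<mu> (i, 1))"
      by blast
    then show ?thesis
    proof cases
      case 1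
      then show ?thesis
        using rounds by simp
    next
      case 2
      \<comment> \<open>The maximum is positive while \<open>midpoint_info\<close> vanishes on the
        diagonal, so the two means in the attained term differ. This gives the strict inequality
        behind the rate, here and in the last case.\<close>
      then have "i \<noteq> 1"
        using max by (auto simp: midpoint_info_self)
      then have less: "\<mu> (i, 1) < \<mu> (1, 1)"
        using later_action_le[OF i] mean_gap by simp
      have "progress_rate (i, j) (midpoint_info (\<mu> (1, 1)) (\<mu> (i, 1)))"
        using range(2) less
      proof (rule progress_rate_action)
        show "\<exists>k\<in>fst ` S. k \<noteq> 1 \<and> \<mu> (k, 1) \<le> \<mu> (i, 1)" if "(i, j) \<in> S" for S
          using that \<open>i \<noteq> 1\<close> by force
      qed
      moreover have "midpoint_info (\<mu> (1, 1)) (\<mu> (i, 1)) \<le> 2"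
        using range less by (intro midpoint_info_le) auto
      moreover have "midpoint_info (\<mu> (1, 1)) (\<mu> (i, 1)) > 0"
        using max unfolding 2 by (subst midpoint_info_commute)
      ultimately have "?L (i, j) \<le> ereal (1 / midpoint_info (\<mu> (1, 1)) (\<mu> (i, 1)))"
        by (intro rate) auto
      then show ?thesis
        unfolding 2 by (subst midpoint_info_commute)
    next
      case 3
      then have "\<mu> (i, j) \<noteq> \<mu> (i, 1)"
        using max by (auto simp: midpoint_info_self)
      then have less: "\<mu> (i, 1) < \<mu> (i, j)"
        using first_arm_le[OF ij] by simp
      have "progress_rate (i, j) (midpoint_info (\<mu> (i, j)) (\<mu> (i, 1)))"
        using progress_rate_high_arm[OF ij] less by simp
      moreover have "midpoint_info (\<mu> (i, j)) (\<mu> (i, 1)) \<le> 2"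
        using range less by (intro midpoint_info_le) auto
      ultimately show ?thesis
        using max unfolding 3 by (intro rate) auto
    qed
  qed
  ultimately show ?thesis
    by blast
qed

end
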